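(* The family $\mathcal{P}_b^+$ of strictly positive bi-decomposable distributions on $S_n$ equals the log-linear model $\mathcal{L}(\Phi_k\times\Phi_\ell:\ 1\le k,\ell\le n)$, and its number of free parameters is \[ d_n=\sum_{i=1}^{n-1} i^2. \]
   Context: $S_n$ is the group of permutations of $\{1,\ldots,n\}$, identified with rook placements on the $n\times n$ board ($\pi$ places rooks at squares $(i,\pi(i))$). A distribution $p$ on $S_n$ is $L$-decomposable if a random permutation $\Pi\sim p$ satisfies, for every $2\le k\le n-2$ and $\pi\in S_n$, $P(\Pi(k+1)=\pi(k+1)\mid (\Pi(1),\ldots,\Pi(k))=(\pi(1),\ldots,\pi(k))) = P(\Pi(k+1)=\pi(k+1)\mid \{\Pi(1),\ldots,\Pi(k)\}=\{\pi(1),\ldots,\pi(k)\})$ whenever the left side is defined; $p$ is bi-decomposable if both $p$ and $p'(\pi)=p(\pi^{-1})$ are $L$-decomposable. A product partition of the board is $\mathcal{B}=\mathcal{R}\times\mathcal{C}=(R_i\times C_j)$ where $\mathcal{R}=(R_1,\ldots,R_r)$, $\mathcal{C}=(C_1,\ldots,C_c)$ are partitions of $\{1,\ldots,n\}$; its marginal is the matrix $|\pi_{\mathcal{B}}|=(t_{ij})$, $t_{ij}=|\{s:(s,\pi(s))\in R_i\times C_j\}|$. Let $U^{\mathcal{B}}=\{v\in\mathbb{R}^{S_n}: |\pi_{\mathcal{B}}|=|\sigma_{\mathcal{B}}|\Rightarrow v(\pi)=v(\sigma)\}$. The log-linear model $\mathcal{L}(\mathcal{B}_1,\ldots,\mathcal{B}_s)$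 is the set of strictly positive probability distributions $p$ on $S_n$ with $\log p\in U:=\mathrm{Span}(U^{\mathcal{B}_1},\ldots,U^{\mathcal{B}_s})$; its number of free parameters is $\dim U-1$. The bold sections are the partitions $\Phi_k=(\{1,\ldots,k-1\},\{k\},\{k+1,\ldots,n\})$ of $\{1,\ldots,n\}$ for $1\le k\le n$ (empty blocks omitted). *)

theory Defs
  imports "HOL-Analysis.Analysis" "HOL-Library.Function_Algebras" "HOL-Combinatorics.Permutations"
begin

definition fscale :: "real \<Rightarrow> ('a \<Rightarrow> real) \<Rightarrow> ('a \<Rightarrow> real)" where
  "fscale c f = (\<lambda>x. c * f x)"

global_interpretation fvs: vector_space fscale
  by unfold_locales (auto simp: fscale_def algebra_simps fun_eq_iff)

definition Sn :: "nat \<Rightarrow> (nat \<Rightarrow> nat) set" where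
  "Sn n = {\<pi>. \<pi> permutes {1..n}}"

definition pos_dist :: "nat \<Rightarrow> ((nat \<Rightarrow> nat) \<Rightarrow> real) set" where
  "pos_dist n = {p. (\<forall>\<pi>\<in>Sn n. p \<pi> > 0) \<and> (\<forall>\<pi>. \<pi> \<notin> Sn n \<longrightarrow> p \<pi> = 0)
                    \<and> (\<Sum>\<pi>\<in>Sn n. p \<pi>) = 1}"

definition prob :: "nat \<Rightarrow> ((nat \<Rightarrow> nat) \<Rightarrow> real) \<Rightarrow> ((nat \<Rightarrow> nat) \<Rightarrow> bool) \<Rightarrow> real" where
  "prob n p E = (\<Sum>\<sigma>\<in>{\<sigma>\<in>Sn n. E \<sigma>}. p \<sigma>)"

text \<open>L-decomposability: for 2 \<le> k \<le> n-2 and \<pi> \<in> S_n, whenever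
  P((\<Pi>(1),...,\<Pi>(k)) = (\<pi>(1),...,\<pi>(k))) > 0 (i.e. the left conditional probability is defined),
  P(\<Pi>(k+1)=\<pi>(k+1) | prefix tuple) = P(\<Pi>(k+1)=\<pi>(k+1) | prefix set).\<close>
definition L_decomposable :: "nat \<Rightarrow> ((nat \<Rightarrow> nat) \<Rightarrow> real) \<Rightarrow> bool" where
  "L_decomposable n p \<longleftrightarrow>
    (\<forall>k. 2 \<le> k \<and> k \<le> n - 2 \<longrightarrow> (\<forall>\<pi>\<in>Sn n.
       prob n p (\<lambda>\<sigma>. \<forall>i\<in>{1..k}. \<sigma> i = \<pi> i) > 0 \<longrightarrow>
       prob n p (\<lambda>\<sigma>. (\<forall>i\<in>{1..k}. \<sigma> i = \<pi> i) \<and> \<sigma> (k+1) = \<pi> (k+1))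
         / prob n p (\<lambda>\<sigma>. \<forall>i\<in>{1..k}. \<sigma> i = \<pi> i)
       = prob n p (\<lambda>\<sigma>. \<sigma> ` {1..k} = \<pi> ` {1..k} \<and> \<sigma> (k+1) = \<pi> (k+1))
         / prob n p (\<lambda>\<sigma>. \<sigma> ` {1..k} = \<pi> ` {1..k})))"

definition bi_decomposable :: "nat \<Rightarrow> ((nat \<Rightarrow> nat) \<Rightarrow> real) \<Rightarrow> bool" where
  "bi_decomposable n p \<longleftrightarrow> L_decomposable n p \<and> L_decomposable n (\<lambda>\<pi>. p (inv \<pi>))"

definition Pb_plus :: "nat \<Rightarrow> ((nat \<Rightarrow> nat) \<Rightarrow> real) set" where
  "Pb_plus n = {p \<in> pos_dist n. bi_decomposable n p}"

text \<open>A product partition R \<times> C is given by two partitions R, C of {1..n} (lists of blocks).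
  The marginal of \<pi> is the matrix t_ij = |{s. (s, \<pi> s) \<in> R_i \<times> C_j}|.\<close>
definition marginal :: "nat set list \<Rightarrow> nat set list \<Rightarrow> (nat \<Rightarrow> nat) \<Rightarrow> nat \<Rightarrow> nat \<Rightarrow> nat" where
  "marginal R C \<pi> i j = card {s. s \<in> R ! i \<and> \<pi> s \<in> C ! j}"

definition marginal_mat :: "nat set list \<Rightarrow> nat set list \<Rightarrow> (nat \<Rightarrow> nat) \<Rightarrow> nat list list" where
  "marginal_mat R C \<pi> = map (\<lambda>i. map (\<lambda>j. marginal R C \<pi> i j) [0..<length C]) [0..<length R]"

definition U_B :: "nat \<Rightarrow> nat set list \<Rightarrow> nat set list \<Rightarrow> ((nat \<Rightarrow> nat) \<Rightarrow> real) set" where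
  "U_B n R C = {v. (\<forall>\<pi>. \<pi> \<notin> Sn n \<longrightarrow> v \<pi> = 0) \<and>
     (\<forall>\<pi>\<in>Sn n. \<forall>\<sigma>\<in>Sn n. marginal_mat R C \<pi> = marginal_mat R C \<sigma> \<longrightarrow> v \<pi> = v \<sigma>)}"

definition U_span :: "nat \<Rightarrow> (nat set list \<times> nat set list) set \<Rightarrow> ((nat \<Rightarrow> nat) \<Rightarrow> real) set" where
  "U_span n Bs = fvs.span (\<Union>(R, C)\<in>Bs. U_B n R C)"

definition loglinear :: "nat \<Rightarrow> (nat set list \<times> nat set list) set \<Rightarrow> ((nat \<Rightarrow> nat) \<Rightarrow> real) set" where
  "loglinear n Bs = {p \<in> pos_dist n.
      (\<lambda>\<pi>. if \<pi> \<in> Sn n then ln (p \<pi>) else 0) \<in> U_span n Bs}"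

definition Phi :: "nat \<Rightarrow> nat \<Rightarrow> nat set list" where
  "Phi n k = filter (\<lambda>B. B \<noteq> {}) [{1..<k}, {k}, {k+1..n}]"

definition bold_family :: "nat \<Rightarrow> (nat set list \<times> nat set list) set" where
  "bold_family n = {(Phi n k, Phi n l) | k l. 1 \<le> k \<and> k \<le> n \<and> 1 \<le> l \<and> l \<le> n}"

end

theory Submission
  imports Defs
begin

text \<open>
  Write \<open>s\<^sub>i\<close> for the transposition of \<open>i\<close> and \<open>i + 1\<close>. If \<open>p\<close> is positive and L-decomposable, then
  \<open>v = log p\<close> satisfies \<open>v(\<pi>) + v(\<pi> s\<^sub>i s\<^sub>j) = v(\<pi> s\<^sub>i) + v(\<pi> s\<^sub>j)\<close> for all commuting \<open>s\<^sub>i\<close>, \<open>s\<^sub>j\<close>. If \<open>p\<close> is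
  bi-decomposable, the same holds for multiplication from the left. Two commuting descents of \<open>\<pi>\<close> or
  of its inverse thus express \<open>v(\<pi>)\<close> by values at permutations with fewer inversions, so \<open>v\<close> is
  determined by its values at permutations for which neither \<open>\<pi>\<close> nor its inverse has commuting
  descents. These are the identity and the permutations exchanging two adjacent blocks, or two blocks
  separated by a single element; there are \<open>1 + 1\<^sup>2 + \<dots> + (n - 1)\<^sup>2\<close> of them.

  Conversely, each such permutation has an indicator function in the span of the bold sections: with
  \<open>r(k, l)\<close> the number of rooks in \<open>{1..k} \<times> {1..l}\<close>, it indicates \<open>r(k, l) = a\<close>, possibly together
  with \<open>\<pi>(k + 1) = l + 1\<close>. The permutation in question is the unique one with fewest inversions in
  the support, so these functions are triangular with respect to the number of inversions. Hence they
  form a basis of the space of all \<open>v\<close> as above, which therefore equals the span.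
\<close>

abbreviation (input) adj :: "nat \<Rightarrow> nat \<Rightarrow> nat" where
  "adj i \<equiv> Transposition.transpose i (Suc i)"

subsection \<open>Inversions and descents\<close>

definition invs :: "nat \<Rightarrow> (nat \<Rightarrow> nat) \<Rightarrow> (nat \<times> nat) set" where
  "invs n \<pi> = {(i, j). i \<in> {1..n} \<and> j \<in> {1..n} \<and> i < j \<and> \<pi> j < \<pi> i}"

lemma finite_invs [simp]: "finite (invs n \<pi>)"
  by (rule finite_subset[of _ "{1..n} \<times> {1..n}"]) (auto simp: invs_def)

lemma finite_Sn [simp]: "finite (Sn n)"
  unfolding Sn_def by (rule finite_permutations) simp

lemma Sn_comp: "\<pi> \<in> Sn n \<Longrightarrow> \<sigma> \<in> Sn n \<Longrightarrow> \<pi> \<circ> \<sigma> \<in> Sn n"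
  by (simp add: Sn_def permutes_compose)

lemma Sn_inv: "\<pi> \<in> Sn n \<Longrightarrow> inv \<pi> \<in> Sn n"
  by (simp add: Sn_def permutes_inv)

lemma Sn_inv_inv: "\<pi> \<in> Sn n \<Longrightarrow> inv (inv \<pi>) = \<pi>"
  by (simp add: Sn_def permutes_inv_inv)

lemma Sn_range: "\<pi> \<in> Sn n \<Longrightarrow> i \<in> {1..n} \<Longrightarrow> \<pi> i \<in> {1..n}"
  unfolding Sn_def by (metis mem_Collect_eq permutes_in_image)

lemma Sn_ge1: "\<pi> \<in> Sn n \<Longrightarrow> Suc 0 \<le> i \<Longrightarrow> Suc 0 \<le> \<pi> i"
  using Sn_range[of \<pi> n i] by (cases "i \<le> n") (auto simp: Sn_def permutes_def)

lemma Sn_le: "\<pi> \<in> Sn n \<Longrightarrow> i \<le> n \<Longrightarrow> \<pi> i \<le> n"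
  using Sn_range[of \<pi> n i] by (cases "1 \<le> i") (auto simp: Sn_def permutes_def)

lemma Sn_inj: "\<pi> \<in> Sn n \<Longrightarrow> inj \<pi>"
  unfolding Sn_def using permutes_inj by auto

lemma adj_Sn: "1 \<le> i \<Longrightarrow> i < n \<Longrightarrow> adj i \<in> Sn n"
  unfolding Sn_def by (auto intro!: permutes_swap_id)

lemma adj_apply:
  "adj i i = Suc i" "adj i (Suc i) = i" "x \<noteq> i \<Longrightarrow> x \<noteq> Suc i \<Longrightarrow> adj i x = x"
  by (auto simp: Transposition.transpose_def)

text \<open>The positions with value at most \<open>\<pi> i\<close> are mapped bijectively onto
  \<open>{1..\<pi> i}\<close>, so a permutation can be recovered from the comparisons between its
  values.\<close>

lemma perm_eq_card:
  assumes "\<pi> \<in> Sn n" "i \<in> {1..n}"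
  shows "\<pi> i = card {j\<in>{1..n}. \<pi> j \<le> \<pi> i}"
proof -
  have p: "\<pi> permutes {1..n}" using assms by (simp add: Sn_def)
  have "\<pi> ` {j\<in>{1..n}. \<pi> j \<le> \<pi> i} = {1..\<pi> i}"
  proof
    show "\<pi> ` {j\<in>{1..n}. \<pi> j \<le> \<pi> i} \<subseteq> {1..\<pi> i}"
      by (auto intro: Sn_ge1[OF assms(1)])
    show "{1..\<pi> i} \<subseteq> \<pi> ` {j\<in>{1..n}. \<pi> j \<le> \<pi> i}"
    proof
      fix v assume v: "v \<in> {1..\<pi> i}"
      then have "v \<in> \<pi> ` {1..n}"
        using Sn_range[OF assms] permutes_image[OF p] by auto
      then show "v \<in> \<pi> ` {j\<in>{1..n}. \<pi> j \<le> \<pi> i}" using v by auto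
    qed
  qed
  moreover have "inj_on \<pi> {j\<in>{1..n}. \<pi> j \<le> \<pi> i}"
    using Sn_inj[OF assms(1)] by (simp add: inj_on_def)
  ultimately show ?thesis
    by (metis card_atLeastAtMost card_image diff_Suc_1)
qed

text \<open>The inversion set decides the comparison of any two values, and by
  \<open>perm_eq_card\<close> these comparisons determine the permutation.\<close>

lemma perm_eq_if_invs_eq:
  assumes "\<pi> \<in> Sn n" "\<sigma> \<in> Sn n" "invs n \<pi> = invs n \<sigma>"
  shows "\<pi> = \<sigma>"
proof
  fix i
  show "\<pi> i = \<sigma> i"
  proof (cases "i \<in> {1..n}")
    case False
    then show ?thesis using assms(1,2) by (simp add: Sn_def permutes_def)
  next
    case i: True
    have "\<pi> j \<le> \<pi> i \<longleftrightarrow> \<sigma> j \<le> \<sigma> i" if j: "j \<in> {1..n}" for j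
    proof -
      have e: "x \<in> {1..n} \<Longrightarrow> y \<in> {1..n} \<Longrightarrow> x < y \<Longrightarrow> \<pi> y < \<pi> x \<longleftrightarrow> \<sigma> y < \<sigma> x" for x y
        using eqset_imp_iff[OF assms(3), of "(x, y)"] by (simp add: invs_def)
      consider "i = j" | "i < j" | "j < i" by linarith
      then show ?thesis
      proof cases
        case 2
        have "\<pi> i \<noteq> \<pi> j" "\<sigma> i \<noteq> \<sigma> j"
          using 2 Sn_inj assms(1,2) by (metis injD less_irrefl)+
        then show ?thesis using e[OF i j 2] by auto
      next
        case 3
        then show ?thesis using e[OF j i 3] by auto
      qed auto
    qed
    then have "{j\<in>{1..n}. \<pi> j \<le> \<pi> i} = {j\<in>{1..n}. \<sigma> j \<le> \<sigma> i}" by blast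
    then show ?thesis using perm_eq_card[OF assms(1) i] perm_eq_card[OF assms(2) i] by simp
  qed
qed

lemma card_values_le:
  assumes "\<pi> \<in> Sn n" "l \<le> n"
  shows "card {i\<in>{1..n}. \<pi> i \<le> l} = l"
proof -
  have "\<pi> ` {i\<in>{1..n}. \<pi> i \<le> l} = {1..l}"
  proof
    show "\<pi> ` {i\<in>{1..n}. \<pi> i \<le> l} \<subseteq> {1..l}" by (auto intro: Sn_ge1[OF assms(1)])
    show "{1..l} \<subseteq> \<pi> ` {i\<in>{1..n}. \<pi> i \<le> l}"
    proof
      fix v assume v: "v \<in> {1..l}"
      then have "v \<in> \<pi> ` {1..n}" using permutes_image[of \<pi> "{1..n}"] assms by (auto simp: Sn_def)
      then show "v \<in> \<pi> ` {i\<in>{1..n}. \<pi> i \<le> l}" using v by auto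
    qed
  qed
  then show ?thesis
    using card_image[OF inj_on_subset[OF Sn_inj[OF assms(1)] subset_UNIV]]
    by (metis card_atLeastAtMost diff_Suc_1)
qed

text \<open>Applying \<open>adj i\<close> to both positions of an inversion of
  \<open>\<pi> \<circ> adj i\<close> preserves their order, since only the pair
  \<open>(i, Suc i)\<close> would be reversed and it is not inverted there. This injects into the
  inversions of \<open>\<pi>\<close> and misses \<open>(i, Suc i)\<close>.\<close>

lemma card_invs_adj:
  assumes "1 \<le> i" "i < n" "\<pi> (Suc i) < \<pi> i"
  shows "card (invs n (\<pi> \<circ> adj i)) < card (invs n \<pi>)"
proof -
  let ?s = "adj i"
  let ?f = "map_prod ?s ?s"
  have inj: "inj_on ?f (invs n (\<pi> \<circ> ?s))"
    by (rule inj_on_subset[OF prod.inj_map]) auto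
  have "?f ` invs n (\<pi> \<circ> ?s) \<subseteq> invs n \<pi> - {(i, Suc i)}"
  proof -
    have "(?s x, ?s y) \<in> invs n \<pi> - {(i, Suc i)}" if "(x, y) \<in> invs n (\<pi> \<circ> ?s)" for x y
    proof -
      have h: "x \<in> {1..n}" "y \<in> {1..n}" "x < y" "\<pi> (?s y) < \<pi> (?s x)"
        using that by (auto simp: invs_def)
      then have "\<not> (x = i \<and> y = Suc i)" using assms(3) by (auto simp: adj_apply)
      then have "?s x < ?s y" using h(3) by (auto simp: Transposition.transpose_def)
      moreover have "?s x \<in> {1..n}" "?s y \<in> {1..n}"
        using Sn_range[OF adj_Sn[OF assms(1,2)]] h by blast+
      moreover have "(?s x, ?s y) \<noteq> (i, Suc i)"
        using h(3) by (auto simp: Transposition.transpose_def split: if_splits)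
      ultimately show ?thesis using h by (auto simp: invs_def)
    qed
    then show ?thesis by auto
  qed
  moreover have "(i, Suc i) \<in> invs n \<pi>" using assms by (auto simp: invs_def)
  ultimately have "?f ` invs n (\<pi> \<circ> ?s) \<subset> invs n \<pi>"
    by (intro psubsetI) (simp_all add: subset_Diff_insert, metis)
  then have "card (?f ` invs n (\<pi> \<circ> ?s)) < card (invs n \<pi>)"
    by (rule psubset_card_mono[OF finite_invs])
  then show ?thesis by (simp only: card_image[OF inj])
qed

lemma card_invs_inv:
  assumes "\<pi> \<in> Sn n"
  shows "card (invs n (inv \<pi>)) = card (invs n \<pi>)"
proof -
  have le: "card (invs n \<pi>) \<le> card (invs n (inv \<pi>))" if p: "\<pi> \<in> Sn n" for \<pi>
  proof (rule card_inj_on_le[where f = "\<lambda>(i, j). (\<pi> j, \<pi> i)"])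
    show "inj_on (\<lambda>(i, j). (\<pi> j, \<pi> i)) (invs n \<pi>)"
      using Sn_inj[OF p] by (auto simp: inj_on_def)
    show "(\<lambda>(i, j). (\<pi> j, \<pi> i)) ` invs n \<pi> \<subseteq> invs n (inv \<pi>)"
      using Sn_inj[OF p] by (auto simp: invs_def inv_f_f intro: Sn_ge1[OF p] Sn_le[OF p])
  qed simp
  show ?thesis
    using le[OF assms] le[OF Sn_inv[OF assms]] by (simp add: Sn_inv_inv[OF assms])
qed

lemma less_if_no_descent:
  fixes f :: "nat \<Rightarrow> nat"
  assumes "x < y" "\<And>d. x \<le> d \<Longrightarrow> d < y \<Longrightarrow> f d < f (Suc d)"
  shows "f x < f y"
  using assms
proof (induction y)
  case (Suc y)
  show ?case
  proof (cases "x = y")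
    case True
    then show ?thesis using Suc.prems by auto
  next
    case False
    then have "f x < f y" using Suc by auto
    also have "f y < f (Suc y)" using Suc.prems by auto
    finally show ?thesis .
  qed
qed simp

lemma initial_segment_eq:
  fixes A :: "nat set"
  assumes "A \<subseteq> {Suc p..q}" "\<And>x y. x \<in> A \<Longrightarrow> p < y \<Longrightarrow> y < x \<Longrightarrow> y \<in> A"
  shows "A = {Suc p..p + card A}"
proof (cases "A = {}")
  case False
  have fin: "finite A" using assms(1) finite_subset by blast
  have m: "Max A \<in> A" using fin False by simp
  have "A = {Suc p..Max A}"
  proof
    show "A \<subseteq> {Suc p..Max A}" using assms(1) fin by auto
    show "{Suc p..Max A} \<subseteq> A"
      using assms(2)[OF m] m by (metis Suc_le_lessD atLeastAtMost_iff le_neq_implies_less subsetI)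
  qed
  moreover then have "card A = Max A - p" by (metis card_atLeastAtMost diff_Suc_Suc)
  moreover have "p < Max A" using m assms(1) by auto
  ultimately show ?thesis by simp
qed simp

subsection \<open>The extremal permutations\<close>

text \<open>The number of rooks in the corner rectangle with \<open>k\<close> rows and
  \<open>l\<close> columns. For positive \<open>k\<close> and \<open>l\<close> it is the corner
  entry of the marginal for \<open>Phi n (k + 1)\<close> and \<open>Phi n (l + 1)\<close>.\<close>

definition rk :: "(nat \<Rightarrow> nat) \<Rightarrow> nat \<Rightarrow> nat \<Rightarrow> nat" where
  "rk \<pi> k l = card {i \<in> {1..k}. \<pi> i \<le> l}"

definition marked :: "nat \<Rightarrow> nat \<times> nat \<times> nat \<times> nat \<Rightarrow> (nat \<Rightarrow> nat) \<Rightarrow> bool" where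
  "marked n = (\<lambda>(k, l, a, e) \<pi>. \<pi> \<in> Sn n \<and> rk \<pi> k l = a \<and> (e = 1 \<longrightarrow> \<pi> (k + 1) = l + 1))"

definition sep :: "nat \<Rightarrow> nat \<Rightarrow> nat \<Rightarrow> nat \<Rightarrow> bool" where
  "sep k e x y \<longleftrightarrow> x \<le> k \<and> k < y \<or> x \<le> k + e \<and> k + e < y"

text \<open>For a marked permutation, the inversions that cross a cut both in position and in value
  are exactly those forced by the marking; tightness excludes all others.\<close>

definition tight :: "nat \<Rightarrow> nat \<times> nat \<times> nat \<times> nat \<Rightarrow> (nat \<Rightarrow> nat) \<Rightarrow> bool" where
  "tight n = (\<lambda>(k, l, a, e) \<pi>. \<forall>(i, j) \<in> invs n \<pi>. sep k e i j \<and> sep l e (\<pi> j) (\<pi> i))"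

text \<open>The blocks to be exchanged have lengths \<open>k - a\<close> and \<open>l - a\<close>,
  so the strict inequalities make them nonempty. The third condition says that they fit into
  \<open>{1..n}\<close> behind \<open>a\<close> fixed points and with \<open>e\<close> elements
  between them.\<close>

definition params :: "nat \<Rightarrow> (nat \<times> nat \<times> nat \<times> nat) set" where
  "params n = {(k, l, a, e). a < k \<and> a < l \<and> k + l + e \<le> n + a \<and> e \<le> 1}"

text \<open>The quadruple \<^term>\<open>(0, 0, 0, 0)\<close> stands for the constant function and the identity.\<close>
definition params0 :: "nat \<Rightarrow> (nat \<times> nat \<times> nat \<times> nat) set" where
  "params0 n = insert (0, 0, 0, 0) (params n)"

lemma params0_bounds:
  assumes "(k, l, a, e) \<in> params0 n"
  shows "a \<le> k" "a \<le> l" "k + l + e \<le> n + a" "e \<le> 1" "k + e \<le> n" "l + e \<le> n"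
  using assms by (auto simp: params0_def params_def)

text \<open>Of the first \<open>k\<close> positions, \<open>a\<close> carry values at most
  \<open>l\<close>, and for \<open>e = 1\<close> the value \<open>l + 1\<close> sits at
  \<open>k + 1\<close>, so the other \<open>k - a\<close> values exceed \<open>l + e\<close>.
  Likewise the small values left over by the first \<open>k\<close> positions must occur after
  \<open>k + e\<close>.\<close>

lemma marked_blocks:
  assumes g: "marked n (k, l, a, e) \<pi>" and j: "(k, l, a, e) \<in> params0 n"
  shows "card {i\<in>{1..k}. l + e < \<pi> i} = k - a"
    and "card {i\<in>{k+e+1..n}. \<pi> i \<le> l} = l - a"
proof -
  note b = params0_bounds[OF j]
  have p: "\<pi> \<in> Sn n" "rk \<pi> k l = a" "e = 1 \<Longrightarrow> \<pi> (k + 1) = l + 1" using g by (auto simp: marked_def)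
  have e01: "e = 0 \<or> e = 1" using b by auto
  have "{i\<in>{1..k}. l + e < \<pi> i} = {1..k} - {i\<in>{1..k}. \<pi> i \<le> l}"
  proof -
    have "\<pi> i \<noteq> l + 1" if "i \<in> {1..k}" "e = 1" for i
    proof -
      have "i \<noteq> k + 1" using that by auto
      then show ?thesis using p(3)[OF that(2)] injD[OF Sn_inj[OF p(1)], of i "k + 1"] by auto
    qed
    then have "l + e < \<pi> i \<longleftrightarrow> \<not> \<pi> i \<le> l" if "i \<in> {1..k}" for i
      using e01 that by fastforce
    then show ?thesis by blast
  qed
  moreover have "card ({1..k} - {i\<in>{1..k}. \<pi> i \<le> l}) = k - a"
    using p(2) by (subst card_Diff_subset) (auto simp: rk_def)
  ultimately show "card {i\<in>{1..k}. l + e < \<pi> i} = k - a" by simp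
  have c: "card {i\<in>{1..n}. \<pi> i \<le> l} = l"
    using card_values_le[OF p(1)] b by simp
  have "{i\<in>{k+e+1..n}. \<pi> i \<le> l} = {i\<in>{1..n}. \<pi> i \<le> l} - {i\<in>{1..k}. \<pi> i \<le> l}"
    using e01
  proof
    assume "e = 1"
    then have "i \<in> {k+e+1..n} \<and> \<pi> i \<le> l \<longleftrightarrow> i \<in> {1..n} \<and> \<pi> i \<le> l \<and> i \<notin> {1..k}" for i
      using p(3) by (cases "i = k + 1") auto
    then show ?thesis by blast
  qed auto
  moreover have "{i\<in>{1..k}. \<pi> i \<le> l} \<subseteq> {i\<in>{1..n}. \<pi> i \<le> l}" using b by auto
  then have "card ({i\<in>{1..n}. \<pi> i \<le> l} - {i\<in>{1..k}. \<pi> i \<le> l}) = l - a"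
    unfolding p(2)[symmetric] rk_def by (subst card_Diff_subset) (use c in simp_all)
  ultimately show "card {i\<in>{k+e+1..n}. \<pi> i \<le> l} = l - a" by simp
qed

text \<open>Tightness makes \<open>\<pi>\<close> increasing on \<open>{1..k}\<close> and on
  \<open>{k+e+1..n}\<close>. The positions with values at most \<open>l\<close> are therefore
  initial segments of these intervals, of lengths \<open>a\<close> and \<open>l - a\<close>, which
  decides every pair crossing a cut. The resulting set depends on the parameters alone.\<close>

lemma invs_eq_if_tight:
  assumes g: "marked n (k, l, a, e) \<pi>" and q: "tight n (k, l, a, e) \<pi>" and j: "(k, l, a, e) \<in> params0 n"
  shows "invs n \<pi> = {(i, j). 1 \<le> i \<and> i < j \<and> j \<le> n \<and> a < i \<and> j \<le> k + e + (l - a) \<and> sep k e i j}"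
proof -
  note b = params0_bounds[OF j]
  have p: "\<pi> \<in> Sn n" "rk \<pi> k l = a" "e = 1 \<Longrightarrow> \<pi> (k + 1) = l + 1" using g by (auto simp: marked_def)
  have e01: "e = 0 \<or> e = 1" using b by auto
  have neq: "x \<noteq> y \<Longrightarrow> \<pi> x \<noteq> \<pi> y" for x y using Sn_inj[OF p(1)] by (metis injD)
  have sepD: "sep k e x y" "sep l e (\<pi> y) (\<pi> x)"
    if "1 \<le> x" "x < y" "y \<le> n" "\<pi> y < \<pi> x" for x y
    using q that unfolding tight_def invs_def by auto
  have mono: "\<pi> x < \<pi> y" if "1 \<le> x" "x < y" "y \<le> n" "\<not> sep k e x y" for x y
    using sepD(1)[OF that(1-3)] that neq[of x y] by force
  have "{i\<in>{1..k}. \<pi> i \<le> l} = {Suc 0..0 + card {i\<in>{1..k}. \<pi> i \<le> l}}"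
  proof (rule initial_segment_eq)
    show "{i\<in>{1..k}. \<pi> i \<le> l} \<subseteq> {Suc 0..k}" by auto
    fix x y assume h: "x \<in> {i\<in>{1..k}. \<pi> i \<le> l}" "0 < y" "y < x"
    have "\<pi> y < \<pi> x" by (rule mono) (use h b e01 in \<open>auto simp: sep_def\<close>)
    then show "y \<in> {i\<in>{1..k}. \<pi> i \<le> l}" using h by auto
  qed
  then have F1: "{i\<in>{1..k}. \<pi> i \<le> l} = {1..a}" using p(2) by (simp add: rk_def)
  have "{i\<in>{k+e+1..n}. \<pi> i \<le> l} = {Suc (k+e)..k + e + card {i\<in>{k+e+1..n}. \<pi> i \<le> l}}"
  proof (rule initial_segment_eq)
    show "{i\<in>{k+e+1..n}. \<pi> i \<le> l} \<subseteq> {Suc (k+e)..n}" by auto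
    fix x y assume h: "x \<in> {i\<in>{k+e+1..n}. \<pi> i \<le> l}" "k + e < y" "y < x"
    have "\<pi> y < \<pi> x" by (rule mono) (use h b e01 in \<open>auto simp: sep_def\<close>)
    then show "y \<in> {i\<in>{k+e+1..n}. \<pi> i \<le> l}" using h by auto
  qed
  then have F2: "{i\<in>{k+e+1..n}. \<pi> i \<le> l} = {Suc (k+e)..k+e+(l-a)}"
    using marked_blocks(2)[OF g j] by simp
  have f1: "\<pi> i \<le> l \<longleftrightarrow> i \<le> a" if "1 \<le> i" "i \<le> k" for i
    using eqset_imp_iff[OF F1, of i] that by simp
  have f2: "\<pi> i \<le> l \<longleftrightarrow> i \<le> k+e+(l-a)" if "k+e < i" "i \<le> n" for i
    using eqset_imp_iff[OF F2, of i] that by simp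
  have "\<pi> y < \<pi> x \<longleftrightarrow> a < x \<and> y \<le> k + e + (l - a) \<and> sep k e x y"
    if h: "1 \<le> x" "x < y" "y \<le> n" for x y
  proof -
    have mid: "e = 1 \<Longrightarrow> z \<noteq> k + 1 \<Longrightarrow> \<pi> z \<noteq> l + 1" for z using neq[of z "k+1"] p(3) by auto
    consider "\<not> sep k e x y" | "x \<le> k" "k + e < y" | "e = 1" "x \<le> k" "y = k + 1"
      | "e = 1" "x = k + 1" "k + e < y"
      using h e01 unfolding sep_def by (metis Suc_eq_plus1 Suc_leI add_0_right le_Suc_eq linorder_not_less order_antisym_conv)
    then show ?thesis
    proof cases
      case 1
      then show ?thesis using mono[OF h 1] by auto
    next
      case 2
      have s: "sep k e x y" using 2 by (auto simp: sep_def)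
      \<comment> \<open>For \<open>e = 1\<close> the value \<open>l + 1\<close> belongs to position
        \<open>k + 1\<close>, so for the outer positions both value cuts amount to the cut after
        \<open>l\<close>.\<close>
      have "\<pi> y < \<pi> x \<longleftrightarrow> l < \<pi> x \<and> \<pi> y \<le> l"
        using sepD(2)[OF h] e01 mid[of y] 2 unfolding sep_def by fastforce
      then show ?thesis using s f1[of x] f2[of y] h 2 by auto
    next
      case 3
      have s: "sep k e x y" using 3 by (auto simp: sep_def)
      have "\<pi> y < \<pi> x \<longleftrightarrow> l < \<pi> x" using 3 p(3) mid[of x] by auto
      then show ?thesis using s f1[of x] h 3 by auto
    next
      case 4
      have s: "sep k e x y" using 4 by (auto simp: sep_def)
      have "\<pi> y < \<pi> x \<longleftrightarrow> \<pi> y \<le> l" using 4 p(3) mid[of y] by auto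
      then show ?thesis using s f2[of y] h 4 b by auto
    qed
  qed
  then show ?thesis by (auto simp: invs_def)
qed

lemma tight_unique:
  assumes "j \<in> params0 n" "marked n j \<pi>" "tight n j \<pi>" "marked n j \<sigma>" "tight n j \<sigma>"
  shows "\<pi> = \<sigma>"
proof -
  obtain k l a e where j: "j = (k, l, a, e)" by (cases j) auto
  show ?thesis
    using assms perm_eq_if_invs_eq[of \<pi> n \<sigma>] invs_eq_if_tight[of n k l a e] unfolding j
    by (simp add: marked_def)
qed

text \<open>The number of forced inversions: the \<open>k - a\<close> early positions with large
  values against the \<open>e\<close> middle positions and the \<open>l - a\<close> late positions
  with small values, and the middle against the latter.\<close>

definition bound :: "nat \<times> nat \<times> nat \<times> nat \<Rightarrow> nat" where
  "bound = (\<lambda>(k, l, a, e). (k - a) * (l - a + e) + e * (l - a))"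

text \<open>The set \<open>N\<close> of forced inversions has \<open>bound j\<close> elements. An
  inversion is separated in positions and in values exactly if it belongs to \<open>N\<close>, so
  having no further inversions means being tight.\<close>

lemma marked_inversions:
  assumes j: "j \<in> params0 n" and g: "marked n j \<pi>"
  shows "bound j \<le> card (invs n \<pi>)" "card (invs n \<pi>) = bound j \<longleftrightarrow> tight n j \<pi>"
proof -
  obtain k l a e where jj: "j = (k, l, a, e)" by (cases j) auto
  note b = params0_bounds[OF j[unfolded jj]]
  note c = marked_blocks[OF g[unfolded jj] j[unfolded jj]]
  have p: "\<pi> \<in> Sn n" "e = 1 \<Longrightarrow> \<pi> (k + 1) = l + 1" using g by (auto simp: marked_def jj)
  have e01: "e = 0 \<or> e = 1" using b by auto
  have neq: "x \<noteq> y \<Longrightarrow> \<pi> x \<noteq> \<pi> y" for x y using Sn_inj[OF p(1)] by (metis injD)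
  define X where "X = {i\<in>{1..k}. l + e < \<pi> i}"
  define Y where "Y = {i\<in>{k+e+1..n}. \<pi> i \<le> l}"
  define M where "M = {k+1..k+e}"
  define N where "N = X \<times> (Y \<union> M) \<union> M \<times> Y"
  have pM: "x \<in> M \<Longrightarrow> \<pi> x = l + 1 \<and> x = k + 1 \<and> e = 1" for x
    using e01 p(2) by (auto simp: M_def)
  have fin: "finite X" "finite Y" "finite M" by (auto simp: X_def Y_def M_def)
  have "card N = card (X \<times> (Y \<union> M)) + card (M \<times> Y)"
    unfolding N_def by (rule card_Un_disjoint) (use fin in \<open>auto simp: X_def M_def\<close>)
  also have "card (X \<times> (Y \<union> M)) = card X * (card Y + card M)"
  proof -
    have "Y \<inter> M = {}" by (auto simp: Y_def M_def)
    then show ?thesis using card_Un_disjoint[of Y M] fin by (simp add: card_cartesian_product)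
  qed
  finally have cN: "card N = bound j"
    using c by (simp add: X_def Y_def M_def card_cartesian_product bound_def jj)
  have sub: "N \<subseteq> invs n \<pi>"
  proof -
    have "(x, y) \<in> invs n \<pi>" if "(x, y) \<in> X \<times> Y" for x y
      using that b by (auto simp: invs_def X_def Y_def)
    moreover have "(x, y) \<in> invs n \<pi>" if "(x, y) \<in> X \<times> M" for x y
      using that b pM[of y] by (auto simp: invs_def X_def)
    moreover have "(x, y) \<in> invs n \<pi>" if "(x, y) \<in> M \<times> Y" for x y
      using that b pM[of x] by (auto simp: invs_def Y_def)
    ultimately show ?thesis unfolding N_def by blast
  qed
  have "bound j = card N" using cN by simp
  also have "\<dots> \<le> card (invs n \<pi>)" using sub by (intro card_mono) auto
  finally show "bound j \<le> card (invs n \<pi>)" .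
  have sepN: "(x, y) \<in> invs n \<pi> \<Longrightarrow> sep k e x y \<and> sep l e (\<pi> y) (\<pi> x) \<longleftrightarrow> (x, y) \<in> N" for x y
  proof -
    assume "(x, y) \<in> invs n \<pi>"
    then have h: "1 \<le> x" "x < y" "y \<le> n" "\<pi> y < \<pi> x" by (auto simp: invs_def)
    have mid: "e = 1 \<Longrightarrow> z \<noteq> k + 1 \<Longrightarrow> \<pi> z \<noteq> l + 1" for z using neq[of z "k+1"] p(2) by auto
    show ?thesis
      using e01
    proof
      assume "e = 0"
      then show ?thesis using h by (auto simp: N_def X_def Y_def M_def sep_def)
    next
      assume e: "e = 1"
      have "x = k + 1 \<longleftrightarrow> \<pi> x = l + 1" "y = k + 1 \<longleftrightarrow> \<pi> y = l + 1"
        using mid[of x] mid[of y] p(2) e by auto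
      then show ?thesis using h e by (auto simp: N_def X_def Y_def M_def sep_def)
    qed
  qed
  have "card (invs n \<pi>) = bound j \<longleftrightarrow> invs n \<pi> = N"
    using card_subset_eq[OF finite_invs sub] cN by auto
  also have "\<dots> \<longleftrightarrow> tight n j \<pi>"
    using sub sepN by (fastforce simp: tight_def jj)
  finally show "card (invs n \<pi>) = bound j \<longleftrightarrow> tight n j \<pi>" .
qed

text \<open>Fixes \<open>{1..a}\<close> and exchanges the blocks \<open>{a+1..k}\<close> and
  \<open>{k+e+1..k+l+e-a}\<close>, each kept in order, shifting the \<open>e\<close> elements
  between them. The quadruple \<open>(0, 0, 0, 0)\<close> gives the identity. Additions precede
  subtractions, so that truncation does no harm.\<close>

definition block_swap :: "nat \<times> nat \<times> nat \<times> nat \<Rightarrow> nat \<Rightarrow> nat" where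
  "block_swap = (\<lambda>(k, l, a, e) i.
     if i \<le> a then i else if i \<le> k then i + l + e - a
     else if i \<le> k + e then i + l - k
     else if i \<le> k + l + e - a then i + a - k - e else i)"

text \<open>Transposing the board exchanges the roles of \<open>k\<close> and
  \<open>l\<close>.\<close>

lemma block_swap_inverse:
  assumes "(k, l, a, e) \<in> params0 n"
  shows "block_swap (l, k, a, e) (block_swap (k, l, a, e) i) = i"
  using params0_bounds[OF assms] by (auto simp: block_swap_def)

lemma params0_sym: "(k, l, a, e) \<in> params0 n \<Longrightarrow> (l, k, a, e) \<in> params0 n"
  by (auto simp: params0_def params_def)

lemma block_swap_Sn:
  assumes j: "(k, l, a, e) \<in> params0 n"
  shows "block_swap (k, l, a, e) \<in> Sn n"
proof -
  have "bij (block_swap (k, l, a, e))"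
    by (rule o_bij[of "block_swap (l, k, a, e)"])
      (auto simp: fun_eq_iff block_swap_inverse[OF j] block_swap_inverse[OF params0_sym[OF j]])
  moreover have "block_swap (k, l, a, e) x = x" if "x \<notin> {1..n}" for x
    using params0_bounds[OF j] that by (auto simp: block_swap_def)
  ultimately show ?thesis
    unfolding Sn_def by (auto simp: permutes_def bij_iff)
qed

lemma inv_block_swap:
  assumes "(k, l, a, e) \<in> params0 n"
  shows "inv (block_swap (k, l, a, e)) = block_swap (l, k, a, e)"
  by (rule inv_unique_comp)
    (auto simp: fun_eq_iff block_swap_inverse[OF assms] block_swap_inverse[OF params0_sym[OF assms]])

lemma block_swap_marked:
  assumes "j \<in> params0 n"
  shows "marked n j (block_swap j)"
proof -
  obtain k l a e where jj: "j = (k, l, a, e)" by (cases j) auto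
  note b = params0_bounds[OF assms[unfolded jj]]
  have "{i\<in>{1..k}. block_swap j i \<le> l} = {1..a}"
    using b by (auto simp: block_swap_def jj)
  moreover have "block_swap j (k + 1) = l + 1" if "e = 1"
    using b that by (auto simp: block_swap_def jj)
  ultimately show ?thesis
    using block_swap_Sn[OF assms[unfolded jj]] by (simp add: marked_def jj rk_def)
qed

lemma block_swap_tight:
  assumes "j \<in> params0 n"
  shows "tight n j (block_swap j)"
proof -
  obtain k l a e where jj: "j = (k, l, a, e)" by (cases j) auto
  note b = params0_bounds[OF assms[unfolded jj]]
  have "sep k e x y \<and> sep l e (block_swap j y) (block_swap j x)"
    if "x < y" "block_swap j y < block_swap j x" for x y
    using that b unfolding block_swap_def jj sep_def by (auto split: if_splits)
  then show ?thesis by (auto simp: tight_def jj invs_def)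
qed

lemma block_swap_descent:
  assumes "(k, l, a, e) \<in> params n"
  shows "block_swap (k, l, a, e) (Suc i) < block_swap (k, l, a, e) i \<longleftrightarrow> i = k \<or> i = k + e"
  using assms by (auto simp: block_swap_def params_def)

text \<open>The descents give \<open>k\<close> and \<open>e\<close>, the descents of the inverse
  give \<open>l\<close>, and then \<open>rk\<close> gives \<open>a\<close>. The identity is
  recognized by having no descent.\<close>

lemma inj_block_swap: "inj_on block_swap (params0 n)"
proof (rule inj_onI)
  fix j j' assume J: "j \<in> params0 n" "j' \<in> params0 n" and eq: "block_swap j = block_swap j'"
  obtain k l a e where jj: "j = (k, l, a, e)" by (cases j) auto
  obtain k' l' a' e' where jj': "j' = (k', l', a', e')" by (cases j') auto
  have z: "block_swap (0, 0, 0, 0) = id" by (auto simp: block_swap_def)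
  have eq': "block_swap (l, k, a, e) = block_swap (l', k', a', e')"
    using eq J inv_block_swap unfolding jj jj' by metis
  have nz: "block_swap (k, l, a, e) \<noteq> id" if "(k, l, a, e) \<in> params n" for k l a e
    using block_swap_descent[OF that, of k] by auto
  consider "j = (0,0,0,0)" "j' = (0,0,0,0)" | "j \<in> params n" "j' \<in> params n"
    using J eq z nz unfolding params0_def jj jj' by (metis insertE)
  then show "j = j'"
  proof cases
    case 2
    have d: "i = k \<or> i = k + e \<longleftrightarrow> i = k' \<or> i = k' + e'" for i
      using block_swap_descent 2 eq unfolding jj jj' by metis
    have "(l, k, a, e) \<in> params n" "(l', k', a', e') \<in> params n"
      using 2 by (auto simp: jj jj' params_def)
    then have d': "i = l \<or> i = l + e \<longleftrightarrow> i = l' \<or> i = l' + e'" for i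
      using block_swap_descent eq' by metis
    have k: "k = k' \<and> e = e'" using d[of k] d[of "k+e"] d[of k'] d[of "k'+e'"] by auto
    have l: "l = l'" using d'[of l] d'[of "l+e"] d'[of l'] d'[of "l'+e'"] by auto
    have "a = rk (block_swap j) k l" "a' = rk (block_swap j') k' l'"
      using block_swap_marked J by (auto simp: marked_def jj jj')
    then show ?thesis using k l eq by (simp add: jj jj')
  qed auto
qed

section \<open>Triangular families of functions\<close>

lemma sum_apply_fun: "(\<Sum>s\<in>I. f s) x = (\<Sum>s\<in>I. f s x)" for f :: "'i \<Rightarrow> 'a \<Rightarrow> real"
  by (induction I rule: infinite_finite_induct) auto

text \<open>Ordered by increasing \<open>\<mu>\<close>, the matrix of the values
  \<open>u j (t i)\<close> is unitriangular, so the coefficients can be chosen one after the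
  other.\<close>

lemma triangular_interpolation:
  fixes u :: "'i \<Rightarrow> 'a \<Rightarrow> real" and \<mu> :: "'i \<Rightarrow> nat"
  assumes "finite I" "\<And>i. i \<in> I \<Longrightarrow> u i (t i) = 1"
    and "\<And>i j. i \<in> I \<Longrightarrow> j \<in> I \<Longrightarrow> u j (t i) \<noteq> 0 \<Longrightarrow> i = j \<or> \<mu> j < \<mu> i"
  shows "\<exists>c. \<forall>i\<in>I. (\<Sum>j\<in>I. c j * u j (t i)) = v (t i)"
  using assms
proof (induction I rule: finite_ranking_induct[where f = \<mu>])
  case (insert x S)
  then obtain c where c: "\<forall>i\<in>S. (\<Sum>j\<in>S. c j * u j (t i)) = v (t i)" by auto
  \<comment> \<open>The new index \<open>x\<close> has the largest \<open>\<mu>\<close>, so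
    \<open>u x\<close> vanishes at all earlier nodes; its coefficient is the error left at
    \<open>t x\<close>.\<close>
  define d where "d = c(x := v (t x) - (\<Sum>j\<in>S. c j * u j (t x)))"
  show ?case
  proof (cases "x \<in> S")
    case True
    then show ?thesis using c by (auto simp: insert_absorb)
  next
    case False
    have s: "(\<Sum>j\<in>S. d j * u j (t i)) = (\<Sum>j\<in>S. c j * u j (t i))" for i
      by (rule sum.cong) (use False in \<open>auto simp: d_def\<close>)
    have "u x (t i) = 0" if "i \<in> S" for i
      using insert.prems(2)[of i x] insert.hyps(2)[OF that] that False by (metis insertI1 insertI2 linorder_not_less)
    then have "\<forall>i\<in>insert x S. (\<Sum>j\<in>insert x S. d j * u j (t i)) = v (t i)"
      using c False insert.hyps(1) insert.prems(1)[of x] by (auto simp: s) (simp add: d_def)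
    then show ?thesis by blast
  qed
qed simp

text \<open>In a vanishing combination, take an index of least \<open>\<mu>\<close> with nonzero
  coefficient and evaluate at its node: every other term is zero there. Injectivity is included
  because independence speaks only of the image set.\<close>

lemma triangular_independent:
  fixes u :: "'i \<Rightarrow> 'a \<Rightarrow> real" and \<mu> :: "'i \<Rightarrow> nat"
  assumes fin: "finite I" and one: "\<And>i. i \<in> I \<Longrightarrow> u i (t i) = 1"
    and tri: "\<And>i j. i \<in> I \<Longrightarrow> j \<in> I \<Longrightarrow> u j (t i) \<noteq> 0 \<Longrightarrow> i = j \<or> \<mu> j < \<mu> i"
  shows "inj_on u I" "fvs.independent (u ` I)"
proof -
  show inj: "inj_on u I"
  proof (rule inj_onI)
    fix i j assume "i \<in> I" "j \<in> I" "u i = u j"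
    then have "i = j \<or> \<mu> j < \<mu> i" "i = j \<or> \<mu> i < \<mu> j"
      using tri[of i j] tri[of j i] one[of i] one[of j] by auto
    then show "i = j" by auto
  qed
  show "fvs.independent (u ` I)"
  proof
    assume "fvs.dependent (u ` I)"
    then obtain f where f: "\<exists>v\<in>u ` I. f v \<noteq> 0" "(\<Sum>v\<in>u ` I. fscale (f v) v) = 0"
      using fvs.dependent_finite[of "u ` I"] fin by auto
    define c where "c i = f (u i)" for i
    have z: "(\<Sum>j\<in>I. c j * u j x) = 0" for x
    proof -
      have "(\<Sum>v\<in>u ` I. fscale (f v) v) = (\<Sum>j\<in>I. fscale (c j) (u j))"
        using inj by (simp add: sum.reindex c_def)
      then have "(\<Sum>j\<in>I. fscale (c j) (u j)) x = 0" using f(2) by simp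
      then show ?thesis by (simp add: sum_apply_fun fscale_def)
    qed
    define i where "i = arg_min_on \<mu> {i\<in>I. c i \<noteq> 0}"
    have ne: "{i\<in>I. c i \<noteq> 0} \<noteq> {}" using f(1) by (auto simp: c_def)
    have i: "i \<in> I" "c i \<noteq> 0" using arg_min_if_finite(1)[OF _ ne, of \<mu>] fin by (auto simp: i_def)
    have min: "\<not> \<mu> j < \<mu> i" if "j \<in> I" "c j \<noteq> 0" for j
      using arg_min_if_finite(2)[OF _ ne, of \<mu>] fin that by (auto simp: i_def)
    have "(\<Sum>j\<in>I. c j * u j (t i)) = (\<Sum>j\<in>{i}. c j * u j (t i))"
    proof (rule sum.mono_neutral_right)
      show "\<forall>j\<in>I - {i}. c j * u j (t i) = 0"
        using tri[OF i(1)] min by fastforce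
    qed (use fin i in auto)
    then show False using z[of "t i"] one[OF i(1)] i(2) by simp
  qed
qed

subsection \<open>Reduction to the extremal permutations\<close>

definition commuting_descents :: "nat \<Rightarrow> (nat \<Rightarrow> nat) \<Rightarrow> bool" where
  "commuting_descents n \<pi> \<longleftrightarrow>
    (\<exists>i j. 1 \<le> i \<and> Suc i < j \<and> j < n \<and> \<pi> (Suc i) < \<pi> i \<and> \<pi> (Suc j) < \<pi> j)"

text \<open>Every inversion spans a descent. Without commuting descents, each descent is the first
  one, \<open>k\<close>, or its successor, and \<open>e\<close> records whether the latter occurs;
  so every inversion crosses one of these cuts.\<close>

lemma descents_without_commuting:
  assumes p: "\<pi> \<in> Sn n" and nc: "\<not> commuting_descents n \<pi>" and ne: "invs n \<pi> \<noteq> {}"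
  obtains k e where "1 \<le> k" "e \<le> 1" "k + e < n" "\<pi> (Suc k) < \<pi> k"
    "\<pi> (Suc (k + e)) < \<pi> (k + e)" "\<And>x y. (x, y) \<in> invs n \<pi> \<Longrightarrow> sep k e x y"
proof -
  define D where "D d \<longleftrightarrow> 1 \<le> d \<and> d < n \<and> \<pi> (Suc d) < \<pi> d" for d
  have neq: "x \<noteq> y \<Longrightarrow> \<pi> x \<noteq> \<pi> y" for x y using Sn_inj[OF p] by (metis injD)
  have ex: "\<exists>d. D d \<and> x \<le> d \<and> d < y" if "(x, y) \<in> invs n \<pi>" for x y
  proof (rule ccontr)
    assume no: "\<nexists>d. D d \<and> x \<le> d \<and> d < y"
    have h: "1 \<le> x" "x < y" "y \<le> n" "\<pi> y < \<pi> x" using that by (auto simp: invs_def)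
    have "\<pi> x < \<pi> y"
    proof (rule less_if_no_descent[OF h(2)])
      fix d assume "x \<le> d" "d < y"
      then show "\<pi> d < \<pi> (Suc d)" using no h neq[of d "Suc d"] unfolding D_def
        by (metis le_trans less_le_trans linorder_neqE_nat n_not_Suc_n)
    qed
    then show False using h by simp
  qed
  then obtain d0 where d0: "D d0" using ne by auto
  define k where "k = (LEAST d. D d)"
  have k: "D k" and kmin: "D d \<Longrightarrow> k \<le> d" for d
    using LeastI[of D, OF d0] Least_le[of D] by (auto simp: k_def)
  define e where "e = (if D (Suc k) then 1 else 0 :: nat)"
  have De: "D (k + e)" using k by (simp add: e_def)
  have only: "d = k \<or> d = k + e" if "D d" for d
  proof -
    have "\<not> Suc k < d" using nc that k unfolding commuting_descents_def D_def by blast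
    then have "d = k \<or> d = Suc k" using kmin[OF that] by auto
    then show ?thesis using that by (auto simp: e_def)
  qed
  show ?thesis
  proof (rule that[of k e])
    show "sep k e x y" if "(x, y) \<in> invs n \<pi>" for x y
      using ex[OF that] only unfolding sep_def by auto
  qed (use k De in \<open>auto simp: D_def e_def\<close>)
qed

lemma invs_inverse: "\<pi> \<in> Sn n \<Longrightarrow> (x, y) \<in> invs n \<pi> \<Longrightarrow> (\<pi> y, \<pi> x) \<in> invs n (inv \<pi>)"
  using Sn_inj[of \<pi> n] by (auto simp: invs_def inv_f_f intro: Sn_ge1 Sn_le)

text \<open>The middle value is the smaller entry of one separated pair and the larger entry of
  another. A single cut cannot achieve both, and with two cuts it must lie between them.\<close>

lemma double_descent_middle:
  assumes p: "\<pi> \<in> Sn n" and k: "1 \<le> k" "k + 1 < n"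
    and d: "\<pi> (Suc k) < \<pi> k" "\<pi> (Suc (Suc k)) < \<pi> (Suc k)"
    and f: "f \<le> 1" "\<And>x y. (x, y) \<in> invs n (inv \<pi>) \<Longrightarrow> sep l f x y"
  shows "f = 1 \<and> \<pi> (Suc k) = Suc l"
proof -
  have "(k, Suc k) \<in> invs n \<pi>" "(Suc k, Suc (Suc k)) \<in> invs n \<pi>"
    using k d by (auto simp: invs_def)
  then have "sep l f (\<pi> (Suc k)) (\<pi> k)" "sep l f (\<pi> (Suc (Suc k))) (\<pi> (Suc k))"
    using f(2) invs_inverse[OF p] by blast+
  then show ?thesis using f(1) by (cases "f = 0") (auto simp: sep_def)
qed

text \<open>The descents of \<open>\<pi>\<close> and of its inverse provide cuts in positions and in
  values. These make \<open>\<pi>\<close> tight for suitable parameters, and a tight marked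
  permutation is unique.\<close>

lemma extremal_if_no_commuting_descents:
  assumes p: "\<pi> \<in> Sn n" and nc: "\<not> commuting_descents n \<pi>" "\<not> commuting_descents n (inv \<pi>)"
  shows "\<exists>j\<in>params0 n. \<pi> = block_swap j"
proof -
  have "\<exists>j\<in>params0 n. marked n j \<pi> \<and> tight n j \<pi>"
  proof (cases "invs n \<pi> = {}")
    case True
    then show ?thesis
      by (intro bexI[of _ "(0, 0, 0, 0)"]) (auto simp: marked_def tight_def rk_def params0_def p)
  next
    case False
    define q where "q = inv \<pi>"
    have q: "q \<in> Sn n" "inv q = \<pi>" using Sn_inv[OF p] Sn_inv_inv[OF p] by (auto simp: q_def)
    have qp: "q (\<pi> x) = x" "\<pi> (q x) = x" for x
      using p by (auto simp: q_def Sn_def permutes_inverses)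
    have "invs n q \<noteq> {}" using False invs_inverse[OF p] by (auto simp: q_def)
    then obtain l f where l: "1 \<le> l" "f \<le> 1" "l + f < n" "q (Suc l) < q l"
        "q (Suc (l + f)) < q (l + f)" "\<And>x y. (x, y) \<in> invs n q \<Longrightarrow> sep l f x y"
      using descents_without_commuting[OF q(1)] nc(2) q_def by metis
    obtain k e where k: "1 \<le> k" "e \<le> 1" "k + e < n" "\<pi> (Suc k) < \<pi> k"
        "\<pi> (Suc (k + e)) < \<pi> (k + e)" "\<And>x y. (x, y) \<in> invs n \<pi> \<Longrightarrow> sep k e x y"
      using descents_without_commuting[OF p nc(1) False] by metis
    \<comment> \<open>A double descent on one side forces a middle rook and thus a double cut on the
      other side, so the two offsets agree.\<close>
    have e1: "e = 1 \<Longrightarrow> f = 1 \<and> \<pi> (Suc k) = Suc l"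
      using double_descent_middle[OF p, of k f l] k l q_def by auto
    have f1: "f = 1 \<Longrightarrow> e = 1"
      using double_descent_middle[OF q(1), of l e k] k l q(2) by auto
    have ef: "f = e" using e1 f1 k(2) l(2) by (cases "e = 1"; cases "f = 1") auto
    \<comment> \<open>The descent at \<open>k\<close> is separated in value, so its larger value
      exceeds \<open>l\<close> and position \<open>k\<close> does not count towards
      \<open>a\<close>; hence \<open>a < k\<close>. Symmetrically, the value \<open>l\<close> occurs
      after position \<open>k\<close>, hence \<open>a < l\<close>.\<close>
    have kp: "l < \<pi> k"
    proof -
      have "(k, Suc k) \<in> invs n \<pi>" using k by (auto simp: invs_def)
      then show ?thesis using l(6) invs_inverse[OF p] by (fastforce simp: sep_def q_def)
    qed
    have lq: "k < q l"
    proof -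
      have "(l, Suc l) \<in> invs n q" using l by (auto simp: invs_def)
      then show ?thesis using k(6) invs_inverse[OF q(1)] q(2) by (fastforce simp: sep_def)
    qed
    define A where "A = {i \<in> {1..k}. \<pi> i \<le> l}"
    define a where "a = rk \<pi> k l"
    have a: "a = card A" by (simp add: a_def A_def rk_def)
    have "k \<in> {1..k} - A" using kp k(1) by (simp add: A_def)
    then have "A \<subset> {1..k}" unfolding A_def by blast
    then have ak: "a < k" using psubset_card_mono[of "{1..k}" A] by (simp add: a)
    have "\<pi> ` A \<subseteq> {1..l} - {l}"
    proof
      fix y assume "y \<in> \<pi> ` A"
      then obtain x where x: "x \<in> {1..k}" "\<pi> x \<le> l" "y = \<pi> x" by (auto simp: A_def)
      have "y \<noteq> l" using lq qp(1)[of x] x by auto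
      then show "y \<in> {1..l} - {l}" using x Sn_ge1[OF p, of x] by simp
    qed
    then have "card (\<pi> ` A) \<le> l - 1" using card_mono[of "{1..l} - {l}" "\<pi> ` A"] l(1) by simp
    then have al: "a < l"
      using l(1) card_image[OF inj_on_subset[OF Sn_inj[OF p] subset_UNIV], of A] by (simp add: a)
    define B where "B = {i \<in> {1..n}. \<pi> i \<le> l}"
    \<comment> \<open>Inclusion and exclusion for the first \<open>k\<close> positions and the
      positions of the \<open>l\<close> smallest values. For \<open>e = 1\<close> both sets avoid
      \<open>k + 1\<close>, which accounts for the summand \<open>e\<close>.\<close>
    have "card {1..k} + card B = card ({1..k} \<union> B) + card ({1..k} \<inter> B)"
      by (rule card_Un_Int) (auto simp: B_def)
    moreover have "{1..k} \<inter> B = A" using k(3) by (auto simp: A_def B_def)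
    moreover have "card ({1..k} \<union> B) \<le> n - e"
    proof -
      have "{1..k} \<union> B \<subseteq> {1..n} - {k + 1..k + e}"
      proof
        fix x assume x: "x \<in> {1..k} \<union> B"
        have "x \<notin> {k + 1..k + e}"
        proof
          assume "x \<in> {k + 1..k + e}"
          then have "e = 1" "x = Suc k" "x \<in> B" using x k(2) by auto
          then show False using e1 by (simp add: B_def)
        qed
        then show "x \<in> {1..n} - {k + 1..k + e}" using x k(3) by (auto simp: B_def)
      qed
      then have "card ({1..k} \<union> B) \<le> card ({1..n} - {k + 1..k + e})" by (rule card_mono[rotated]) simp
      also have "\<dots> = n - e" using k by (subst card_Diff_subset) auto
      finally show ?thesis .
    qed
    ultimately have "k + l + e \<le> n + a"
      using card_values_le[OF p, of l] l k by (simp add: a B_def)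
    then have "(k, l, a, e) \<in> params0 n" using ak al k by (simp add: params0_def params_def)
    moreover have "marked n (k, l, a, e) \<pi>" using p e1 by (auto simp: marked_def a_def)
    moreover have "tight n (k, l, a, e) \<pi>"
      using k(6) l(6) invs_inverse[OF p] unfolding tight_def ef q_def by fastforce
    ultimately show ?thesis by blast
  qed
  then show ?thesis using tight_unique block_swap_marked block_swap_tight by metis
qed

definition flat :: "nat \<Rightarrow> ((nat \<Rightarrow> nat) \<Rightarrow> real) \<Rightarrow> bool" where
  "flat n v \<longleftrightarrow> (\<forall>\<pi>\<in>Sn n. \<forall>i j. 1 \<le> i \<and> Suc i < j \<and> j < n \<longrightarrow>
     v \<pi> + v (\<pi> \<circ> adj i \<circ> adj j) = v (\<pi> \<circ> adj i) + v (\<pi> \<circ> adj j))"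

lemma flat_reduce:
  assumes fl: "flat n v" and p: "\<pi> \<in> Sn n" and cd: "commuting_descents n \<pi>"
    and IH: "\<And>\<sigma>. \<sigma> \<in> Sn n \<Longrightarrow> card (invs n \<sigma>) < card (invs n \<pi>) \<Longrightarrow> v \<sigma> = 0"
  shows "v \<pi> = 0"
proof -
  obtain i j where ij: "1 \<le> i" "Suc i < j" "j < n" "\<pi> (Suc i) < \<pi> i" "\<pi> (Suc j) < \<pi> j"
    using cd by (auto simp: commuting_descents_def)
  have 1: "card (invs n (\<pi> \<circ> adj i)) < card (invs n \<pi>)" using card_invs_adj ij by simp
  have 2: "card (invs n (\<pi> \<circ> adj j)) < card (invs n \<pi>)" using card_invs_adj ij by simp
  have "card (invs n (\<pi> \<circ> adj i \<circ> adj j)) < card (invs n (\<pi> \<circ> adj i))"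
    using ij by (intro card_invs_adj) (auto simp: adj_apply)
  then have 3: "card (invs n (\<pi> \<circ> adj i \<circ> adj j)) < card (invs n \<pi>)" using 1 by simp
  have S: "adj i \<in> Sn n" "adj j \<in> Sn n" using ij by (auto intro: adj_Sn)
  have "v (\<pi> \<circ> adj i) = 0" "v (\<pi> \<circ> adj j) = 0" "v (\<pi> \<circ> adj i \<circ> adj j) = 0"
    using IH[OF _ 1] IH[OF _ 2] IH[OF _ 3] S p by (auto intro: Sn_comp)
  moreover have "v \<pi> + v (\<pi> \<circ> adj i \<circ> adj j) = v (\<pi> \<circ> adj i) + v (\<pi> \<circ> adj j)"
    using fl p ij unfolding flat_def by blast
  ultimately show ?thesis by simp
qed

text \<open>Induction on the number of inversions: at commuting descents, the other three corners of
  the square have fewer. For commuting descents of the inverse, the reduction is applied at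
  \<open>inv \<pi>\<close> to \<open>v\<close> composed with inversion, and \<open>inv \<pi>\<close>
  has as many inversions as \<open>\<pi>\<close>.\<close>

lemma flat_eq_0:
  assumes fl: "flat n v" "flat n (\<lambda>\<pi>. v (inv \<pi>))"
    and z: "\<And>j. j \<in> params0 n \<Longrightarrow> v (block_swap j) = 0" and p: "\<pi> \<in> Sn n"
  shows "v \<pi> = 0"
  using p
proof (induction "card (invs n \<pi>)" arbitrary: \<pi> rule: less_induct)
  case less
  consider "commuting_descents n \<pi>" | "commuting_descents n (inv \<pi>)" | "\<exists>j\<in>params0 n. \<pi> = block_swap j"
    using extremal_if_no_commuting_descents less.prems by blast
  then show ?case
  proof cases
    case 1
    then show ?thesis using flat_reduce[OF fl(1) less.prems] less.hyps by blast
  next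
    case 2
    have "v (inv (inv \<pi>)) = 0"
    proof (rule flat_reduce[OF fl(2) Sn_inv[OF less.prems] 2])
      fix \<sigma> assume s: "\<sigma> \<in> Sn n" "card (invs n \<sigma>) < card (invs n (inv \<pi>))"
      show "v (inv \<sigma>) = 0"
        by (rule less.hyps) (use s less.prems in \<open>simp_all add: card_invs_inv Sn_inv\<close>)
    qed
    then show ?thesis by (simp add: Sn_inv_inv[OF less.prems])
  next
    case 3
    then show ?thesis using z by auto
  qed
qed

subsection \<open>L-decomposability as a factorization property\<close>

text \<open>The value 0 outside \<open>Sn n\<close> matches the functions in \<open>U_B\<close>,
  which vanish there.\<close>

definition log_dist :: "nat \<Rightarrow> ((nat \<Rightarrow> nat) \<Rightarrow> real) \<Rightarrow> (nat \<Rightarrow> nat) \<Rightarrow> real" where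
  "log_dist n p = (\<lambda>\<pi>. if \<pi> \<in> Sn n then ln (p \<pi>) else 0)"

lemma perm_eq_if_eq_below:
  assumes "\<sigma> \<in> Sn n" "\<pi> \<in> Sn n" "\<And>x. x \<in> {1..n-1} \<Longrightarrow> \<sigma> x = \<pi> x"
  shows "\<sigma> = \<pi>"
proof
  have s: "\<sigma> permutes {1..n}" and p: "\<pi> permutes {1..n}" using assms by (auto simp: Sn_def)
  fix x
  consider "x \<notin> {1..n}" | "x \<in> {1..n-1}" | "x = n" "1 \<le> n" by fastforce
  then show "\<sigma> x = \<pi> x"
  proof cases
    case 1
    then show ?thesis using s p by (simp add: permutes_def)
  next
    case 2
    then show ?thesis using assms(3) by blast
  next
    case 3
    have "\<sigma> n \<in> \<pi> ` {1..n}" using Sn_range[OF assms(1), of n] permutes_image[OF p] 3 by auto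
    then obtain y where y: "y \<in> {1..n}" "\<sigma> n = \<pi> y" by blast
    have "y = n"
    proof (rule ccontr)
      assume "y \<noteq> n"
      then have "\<sigma> y = \<sigma> n" using y assms(3)[of y] by auto
      then show False using injD[OF Sn_inj[OF assms(1)]] \<open>y \<noteq> n\<close> by blast
    qed
    then show ?thesis using y 3 by simp
  qed
qed

lemma prob_pos:
  assumes "\<forall>\<pi>\<in>Sn n. p \<pi> > 0" "\<pi> \<in> Sn n" "E \<pi>"
  shows "prob n p E > 0"
  unfolding prob_def by (rule sum_pos) (use assms in auto)

text \<open>The ratio is the conditional probability of the tail given the ordered prefix.
  L-decomposability splits it into factors that see the prefix only as a set, and these agree for
  \<open>\<pi>\<close> and \<open>\<sigma>\<close>.\<close>

lemma tail_ratio_eq: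
  assumes pos: "\<forall>\<pi>\<in>Sn n. p \<pi> > 0" and L: "L_decomposable n p"
    and p: "\<pi> \<in> Sn n" and s: "\<sigma> \<in> Sn n" and k: "2 \<le> k" "k \<le> n - 1"
    and im: "\<pi> ` {1..k} = \<sigma> ` {1..k}" and tl: "\<And>x. k < x \<Longrightarrow> \<pi> x = \<sigma> x"
  shows "p \<pi> / prob n p (\<lambda>\<tau>. \<forall>i\<in>{1..k}. \<tau> i = \<pi> i) = p \<sigma> / prob n p (\<lambda>\<tau>. \<forall>i\<in>{1..k}. \<tau> i = \<sigma> i)"
proof -
  define P where "P m \<pi> = prob n p (\<lambda>\<tau>. \<forall>i\<in>{1..m}. \<tau> i = \<pi> i)" for m \<pi>
  have Ppos: "P m \<pi> > 0" if "\<pi> \<in> Sn n" for m \<pi>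
    unfolding P_def by (rule prob_pos[OF pos that]) auto
  have P_last: "P (n - 1) \<pi> = p \<pi>" if "\<pi> \<in> Sn n" for \<pi>
  proof -
    have "{\<tau> \<in> Sn n. \<forall>i\<in>{1..n-1}. \<tau> i = \<pi> i} = {\<pi>}"
      using perm_eq_if_eq_below that by blast
    then show ?thesis by (simp add: P_def prob_def)
  qed
  have ims: "\<pi> ` {1..m} = \<sigma> ` {1..m}" if "k \<le> m" for m
  proof -
    have "{1..m} = {1..k} \<union> {k<..m}" using that by auto
    moreover have "\<pi> ` {k<..m} = \<sigma> ` {k<..m}" using tl by (intro image_cong) auto
    ultimately show ?thesis using im by (metis image_Un)
  qed
  define C where "C m \<pi> = prob n p (\<lambda>\<tau>. \<tau> ` {1..m} = \<pi> ` {1..m} \<and> \<tau> (m + 1) = \<pi> (m + 1))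
       / prob n p (\<lambda>\<tau>. \<tau> ` {1..m} = \<pi> ` {1..m})" for m \<pi>
  have P_Suc: "P (Suc m) \<pi> = P m \<pi> * C m \<pi>" if "\<pi> \<in> Sn n" "2 \<le> m" "m \<le> n - 2" for m \<pi>
  proof -
    have "(\<forall>i\<in>{1..Suc m}. \<tau> i = \<pi> i) \<longleftrightarrow> (\<forall>i\<in>{1..m}. \<tau> i = \<pi> i) \<and> \<tau> (m + 1) = \<pi> (m + 1)" for \<tau>
      by (auto simp: le_Suc_eq)
    then have "P (Suc m) \<pi> / P m \<pi> = C m \<pi>"
      using L that Ppos[OF that(1), of m] unfolding L_decomposable_def P_def C_def by simp
    then show ?thesis using Ppos[OF that(1), of m] by (simp add: field_simps)
  qed
  \<comment> \<open>Start from prefix length \<open>n - 1\<close>, where a prefix identifies the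
    permutation and both ratios are 1, and descend to \<open>k\<close>; each step multiplies both
    ratios by the same factor.\<close>
  have "p \<pi> / P k \<pi> = p \<sigma> / P k \<sigma>"
    using k(2)
  proof (induction rule: inc_induct)
    case base
    have "p \<pi> \<noteq> 0" "p \<sigma> \<noteq> 0" using pos p s by force+
    then show ?case unfolding P_last[OF p] P_last[OF s] by simp
  next
    case (step m)
    have m: "2 \<le> m" "m \<le> n - 2" using step.hyps k by auto
    have C: "C m \<pi> = C m \<sigma>"
      using ims[of m] tl[of "m + 1"] step.hyps by (simp add: C_def)
    have "C m \<pi> \<noteq> 0"
      using Ppos[OF p, of "Suc m"] P_Suc[OF p m] by auto
    then show ?case
      using step.IH Ppos[OF p, of m] Ppos[OF s, of m]
        P_Suc[OF p m]
        P_Suc[OF s m] C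
      by (simp add: field_simps)
  qed
  then show ?thesis by (simp add: P_def)
qed

lemma cross_multiply:
  fixes a b c d s t :: real
  assumes "a / s = b / t" "c / s = d / t" "s > 0" "t > 0"
  shows "a * d = b * c"
proof -
  have e: "a * t = b * s" "c * t = d * s" using assms by (simp_all add: frac_eq_eq)
  have "s * (a * d) = a * (d * s)" by simp
  also have "\<dots> = (a * t) * c" unfolding e(2)[symmetric] by simp
  also have "\<dots> = s * (b * c)" unfolding e(1) by simp
  finally show ?thesis using assms(3) by simp
qed

text \<open>Cut after \<open>Suc i\<close>. Then \<open>adj i\<close> only reorders the prefix and
  keeps the conditional probability of the tail, while \<open>adj j\<close> only changes the tail
  and keeps the prefix probability. Comparing two such ratios eliminates the prefix
  probabilities.\<close>

lemma L_decomposable_imp_commuting_square: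
  assumes pos: "\<forall>\<pi>\<in>Sn n. p \<pi> > 0" and L: "L_decomposable n p"
    and p: "\<pi> \<in> Sn n" and ij: "1 \<le> i" "Suc i < j" "j < n"
  shows "p \<pi> * p (\<pi> \<circ> adj i \<circ> adj j) = p (\<pi> \<circ> adj i) * p (\<pi> \<circ> adj j)"
proof -
  \<comment> \<open>This cut lies between 2 and \<open>n - 2\<close>, the range covered by
    L-decomposability.\<close>
  define k where "k = Suc i"
  define P where "P \<pi> = prob n p (\<lambda>\<tau>. \<forall>i\<in>{1..k}. \<tau> i = \<pi> i)" for \<pi>
  have Ppos: "P \<pi> > 0" if "\<pi> \<in> Sn n" for \<pi>
    unfolding P_def by (rule prob_pos[OF pos that]) auto
  have S: "adj i \<in> Sn n" "adj j \<in> Sn n" using ij by (auto intro: adj_Sn)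
  have im: "adj i ` {1..k} = {1..k}"
    by (rule permutes_image) (use ij in \<open>auto simp: k_def intro: permutes_swap_id\<close>)
  have ratio: "p \<sigma> / P \<sigma> = p (\<sigma> \<circ> adj i) / P (\<sigma> \<circ> adj i)" if "\<sigma> \<in> Sn n" for \<sigma>
    unfolding P_def
  proof (rule tail_ratio_eq[OF pos L that])
    show "\<sigma> \<circ> adj i \<in> Sn n" by (rule Sn_comp[OF that S(1)])
    show "\<sigma> ` {1..k} = (\<sigma> \<circ> adj i) ` {1..k}" unfolding image_comp[symmetric] im ..
    show "\<And>x. k < x \<Longrightarrow> \<sigma> x = (\<sigma> \<circ> adj i) x" by (auto simp: k_def adj_apply)
  qed (use ij k_def in auto)
  have pre: "P (\<sigma> \<circ> adj j) = P \<sigma>" for \<sigma>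
    unfolding P_def using ij by (simp add: k_def adj_apply)
  have comm: "\<pi> \<circ> adj i \<circ> adj j = \<pi> \<circ> adj j \<circ> adj i"
    using ij by (auto simp: fun_eq_iff Transposition.transpose_def)
  have s: "\<pi> \<circ> adj i \<in> Sn n" "\<pi> \<circ> adj j \<in> Sn n" using p S by (auto intro: Sn_comp)
  have "p \<pi> / P \<pi> = p (\<pi> \<circ> adj i) / P (\<pi> \<circ> adj i)" by (rule ratio[OF p])
  moreover have "p (\<pi> \<circ> adj j) / P \<pi> = p (\<pi> \<circ> adj i \<circ> adj j) / P (\<pi> \<circ> adj i)"
    using ratio[OF s(2)] pre[of \<pi>] pre[of "\<pi> \<circ> adj i"] comm by simp
  ultimately show ?thesis
    using cross_multiply Ppos[OF p] Ppos[OF s(1)] by blast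
qed

text \<open>For \<open>v = log p\<close> with \<open>p\<close> positive: given the set of the first
  \<open>k\<close> values, their order and the order of the remaining values are conditionally
  independent. This strengthens \<open>flat\<close> from adjacent transpositions to all permutations
  of the two parts.\<close>

definition cut_flat :: "nat \<Rightarrow> ((nat \<Rightarrow> nat) \<Rightarrow> real) \<Rightarrow> bool" where
  "cut_flat n v \<longleftrightarrow> (\<forall>\<pi>\<in>Sn n. \<forall>k\<le>n. \<forall>\<tau> \<rho>. \<tau> permutes {1..k} \<and> \<rho> permutes {k+1..n} \<longrightarrow>
     v (\<pi> \<circ> \<tau> \<circ> \<rho>) + v \<pi> = v (\<pi> \<circ> \<tau>) + v (\<pi> \<circ> \<rho>))"

lemma permutes_below_Sn: "\<tau> permutes {1..k} \<Longrightarrow> k \<le> n \<Longrightarrow> \<tau> \<in> Sn n"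
  unfolding Sn_def by (auto intro: permutes_subset)

lemma permutes_above_Sn: "\<rho> permutes {k+1..n} \<Longrightarrow> \<rho> \<in> Sn n"
  unfolding Sn_def by (auto intro: permutes_subset)

text \<open>Sharing the prefix set with \<open>\<pi>\<close> means lying in the left coset of
  \<open>\<pi>\<close> by the stabilizer of \<open>{1..k}\<close>, which is the direct product of
  the permutation groups of the two parts.\<close>

lemma bij_betw_cut:
  assumes p: "\<pi> \<in> Sn n" and k: "k \<le> n"
  shows "bij_betw (\<lambda>(\<tau>, \<rho>). \<pi> \<circ> \<tau> \<circ> \<rho>) ({\<tau>. \<tau> permutes {1..k}} \<times> {\<rho>. \<rho> permutes {k+1..n}})
    {\<sigma>\<in>Sn n. \<sigma> ` {1..k} = \<pi> ` {1..k}}"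
proof (rule bij_betw_imageI)
  have lo: "(\<tau> \<circ> \<rho>) x = \<tau> x" if "\<rho> permutes {k+1..n}" "x \<le> k" for \<tau> \<rho> :: "nat \<Rightarrow> nat" and x
    using that by (simp add: permutes_def)
  have hi: "(\<tau> \<circ> \<rho>) x = \<rho> x" if "\<tau> permutes {1..k}" "\<rho> permutes {k+1..n}" "k < x" for \<tau> \<rho> :: "nat \<Rightarrow> nat" and x
  proof -
    have "k < \<rho> x"
      using permutes_in_image[OF that(2), of x] that(2,3) by (cases "x \<le> n") (auto simp: permutes_def)
    then show ?thesis using that(1) by (simp add: permutes_def)
  qed
  show "inj_on (\<lambda>(\<tau>, \<rho>). \<pi> \<circ> \<tau> \<circ> \<rho>) ({\<tau>. \<tau> permutes {1..k}} \<times> {\<rho>. \<rho> permutes {k+1..n}})"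
  proof (rule inj_onI, clarsimp)
    fix \<tau> \<rho> \<tau>' \<rho>' :: "nat \<Rightarrow> nat"
    assume h: "\<tau> permutes {Suc 0..k}" "\<rho> permutes {Suc k..n}" "\<tau>' permutes {Suc 0..k}" "\<rho>' permutes {Suc k..n}"
      and eq: "\<pi> \<circ> \<tau> \<circ> \<rho> = \<pi> \<circ> \<tau>' \<circ> \<rho>'"
    have e: "(\<tau> \<circ> \<rho>) x = (\<tau>' \<circ> \<rho>') x" for x
      using fun_cong[OF eq, of x] injD[OF Sn_inj[OF p]] by auto
    have "\<tau> x = \<tau>' x" for x
      using e[of x] lo[of \<rho> x \<tau>] lo[of \<rho>' x \<tau>'] h by (cases "x \<le> k") (auto simp: permutes_def)
    moreover have "\<rho> x = \<rho>' x" for x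
      using e[of x] hi[of \<tau> \<rho> x] hi[of \<tau>' \<rho>' x] h by (cases "x \<le> k") (auto simp: permutes_def)
    ultimately show "\<tau> = \<tau>' \<and> \<rho> = \<rho>'" by auto
  qed
  show "(\<lambda>(\<tau>, \<rho>). \<pi> \<circ> \<tau> \<circ> \<rho>) ` ({\<tau>. \<tau> permutes {1..k}} \<times> {\<rho>. \<rho> permutes {k+1..n}}) =
    {\<sigma>\<in>Sn n. \<sigma> ` {1..k} = \<pi> ` {1..k}}"
  proof (intro equalityI subsetI)
    fix \<sigma> assume "\<sigma> \<in> (\<lambda>(\<tau>, \<rho>). \<pi> \<circ> \<tau> \<circ> \<rho>) ` ({\<tau>. \<tau> permutes {1..k}} \<times> {\<rho>. \<rho> permutes {k+1..n}})"
    then obtain \<tau> \<rho> where h: "\<tau> permutes {1..k}" "\<rho> permutes {k+1..n}" "\<sigma> = \<pi> \<circ> \<tau> \<circ> \<rho>" by auto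
    have "\<sigma> ` {1..k} = \<pi> ` (\<tau> ` {1..k})"
      unfolding h(3) image_image by (rule image_cong) (use lo[OF h(2)] in auto)
    then show "\<sigma> \<in> {\<sigma>\<in>Sn n. \<sigma> ` {1..k} = \<pi> ` {1..k}}"
      using h p permutes_image[OF h(1)] permutes_below_Sn[OF h(1) k] permutes_above_Sn[OF h(2)] by (auto intro: Sn_comp)
  next
    fix \<sigma> assume "\<sigma> \<in> {\<sigma>\<in>Sn n. \<sigma> ` {1..k} = \<pi> ` {1..k}}"
    then have s: "\<sigma> \<in> Sn n" "\<sigma> ` {1..k} = \<pi> ` {1..k}" by auto
    define \<theta> where "\<theta> = inv \<pi> \<circ> \<sigma>"
    have th: "\<theta> permutes {1..n}" using Sn_comp[OF Sn_inv[OF p] s(1)] by (simp add: \<theta>_def Sn_def)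
    have im: "\<theta> ` {1..k} = {1..k}"
      unfolding \<theta>_def image_comp[symmetric] s(2) using Sn_inj[OF p] by (simp add: image_inv_f_f)
    have im2: "\<theta> ` {k+1..n} = {k+1..n}"
    proof -
      have "{k+1..n} = {1..n} - {1..k}" by auto
      then show ?thesis
        using image_set_diff[OF permutes_inj[OF th], of "{1..n}" "{1..k}"] im permutes_image[OF th] by simp
    qed
    have bij: "bij_betw \<theta> {1..k} {1..k}" "bij_betw \<theta> {k+1..n} {k+1..n}"
      using im im2 permutes_inj[OF th] by (auto simp: bij_betw_def intro: inj_on_subset)
    define \<tau> where "\<tau> x = (if x \<in> {1..k} then \<theta> x else x)" for x
    define \<rho> where "\<rho> x = (if x \<in> {k+1..n} then \<theta> x else x)" for x
    have t: "\<tau> permutes {1..k}"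
    proof (rule bij_imp_permutes)
      show "bij_betw \<tau> {1..k} {1..k}"
        using bij(1) by (rule bij_betw_cong[THEN iffD1, rotated]) (simp add: \<tau>_def)
    qed (auto simp: \<tau>_def)
    have r: "\<rho> permutes {k+1..n}"
    proof (rule bij_imp_permutes)
      show "bij_betw \<rho> {k+1..n} {k+1..n}"
        using bij(2) by (rule bij_betw_cong[THEN iffD1, rotated]) (simp add: \<rho>_def)
    qed (auto simp: \<rho>_def)
    have "\<theta> = \<tau> \<circ> \<rho>"
    proof
      fix x show "\<theta> x = (\<tau> \<circ> \<rho>) x"
        using lo[OF r, of x \<tau>] hi[OF t r, of x] th
        by (cases "x \<le> k") (auto simp: \<tau>_def \<rho>_def permutes_def)
    qed
    then have "\<sigma> = \<pi> \<circ> \<tau> \<circ> \<rho>"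
      using p by (metis Sn_def \<theta>_def comp_assoc id_comp mem_Collect_eq permutes_inv_o(1))
    then show "\<sigma> \<in> (\<lambda>(\<tau>, \<rho>). \<pi> \<circ> \<tau> \<circ> \<rho>) ` ({\<tau>. \<tau> permutes {1..k}} \<times> {\<rho>. \<rho> permutes {k+1..n}})"
      using t r by (intro image_eqI[of _ _ "(\<tau>, \<rho>)"]) auto
  qed
qed

text \<open>Flatness factors \<open>p\<close> on each coset of permutations with a common prefix
  set. All four events combine a condition on the prefix with one on the tail, so their
  probabilities factor and the prefix contributions cancel.\<close>

lemma L_decomposable_if_cut_flat:
  assumes pos: "\<forall>\<pi>\<in>Sn n. p \<pi> > 0" and fl: "cut_flat n (log_dist n p)"
  shows "L_decomposable n p"
  unfolding L_decomposable_def
proof (intro allI impI ballI)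
  fix k \<pi> assume k: "2 \<le> k \<and> k \<le> n - 2" and p: "\<pi> \<in> Sn n"
  have kn: "k \<le> n" "k < n" using k by arith+
  define A where "A = {\<tau>. \<tau> permutes {1..k}}"
  define B where "B = {\<rho>. \<rho> permutes {k+1..n}}"
  define B' where "B' = {\<rho>\<in>B. \<rho> (k + 1) = k + 1}"
  have fac: "p (\<pi> \<circ> \<tau> \<circ> \<rho>) = p (\<pi> \<circ> \<tau>) * p (\<pi> \<circ> \<rho>) / p \<pi>" if "\<tau> \<in> A" "\<rho> \<in> B" for \<tau> \<rho>
  proof -
    have t: "\<tau> \<in> Sn n" "\<rho> \<in> Sn n"
      using that kn permutes_below_Sn permutes_above_Sn by (auto simp: A_def B_def)
    have S: "\<pi> \<circ> \<tau> \<circ> \<rho> \<in> Sn n" "\<pi> \<circ> \<tau> \<in> Sn n" "\<pi> \<circ> \<rho> \<in> Sn n"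
      using t p by (auto intro: Sn_comp)
    have P: "p (\<pi> \<circ> \<tau> \<circ> \<rho>) > 0" "p (\<pi> \<circ> \<tau>) > 0" "p (\<pi> \<circ> \<rho>) > 0" "p \<pi> > 0"
      using pos S p by blast+
    have "ln (p (\<pi> \<circ> \<tau> \<circ> \<rho>)) + ln (p \<pi>) = ln (p (\<pi> \<circ> \<tau>)) + ln (p (\<pi> \<circ> \<rho>))"
      using fl p kn that S unfolding cut_flat_def log_dist_def A_def B_def by fastforce
    then have "ln (p (\<pi> \<circ> \<tau> \<circ> \<rho>) * p \<pi>) = ln (p (\<pi> \<circ> \<tau>) * p (\<pi> \<circ> \<rho>))"
      using P by (simp add: ln_mult_pos)
    then have "p (\<pi> \<circ> \<tau> \<circ> \<rho>) * p \<pi> = p (\<pi> \<circ> \<tau>) * p (\<pi> \<circ> \<rho>)"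
      using P by (simp add: ln_inj_iff)
    then show ?thesis using P by (simp add: field_simps)
  qed
  have pr: "prob n p E = (\<Sum>\<tau>\<in>X. p (\<pi> \<circ> \<tau>)) * (\<Sum>\<rho>\<in>Y. p (\<pi> \<circ> \<rho>)) / p \<pi>"
    if sub: "X \<subseteq> A" "Y \<subseteq> B" and E0: "\<And>\<sigma>. \<sigma> \<in> Sn n \<Longrightarrow> E \<sigma> \<Longrightarrow> \<sigma> ` {1..k} = \<pi> ` {1..k}"
      and E: "\<And>\<tau> \<rho>. \<tau> \<in> A \<Longrightarrow> \<rho> \<in> B \<Longrightarrow> E (\<pi> \<circ> \<tau> \<circ> \<rho>) \<longleftrightarrow> \<tau> \<in> X \<and> \<rho> \<in> Y" for E X Y
  proof -
    let ?f = "\<lambda>(\<tau>, \<rho>). \<pi> \<circ> \<tau> \<circ> \<rho>"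
    have bij: "bij_betw ?f (A \<times> B) {\<sigma>\<in>Sn n. \<sigma> ` {1..k} = \<pi> ` {1..k}}"
      unfolding A_def B_def by (rule bij_betw_cut[OF p kn(1)])
    have "bij_betw ?f (X \<times> Y) {\<sigma>\<in>Sn n. E \<sigma>}"
    proof (rule bij_betw_subset[OF bij])
      show "X \<times> Y \<subseteq> A \<times> B" using sub by auto
      show "?f ` (X \<times> Y) = {\<sigma>\<in>Sn n. E \<sigma>}"
      proof (intro equalityI subsetI)
        fix \<sigma> assume "\<sigma> \<in> ?f ` (X \<times> Y)"
        then show "\<sigma> \<in> {\<sigma>\<in>Sn n. E \<sigma>}"
          using bij_betw_imp_surj_on[OF bij] sub E by fastforce
      next
        fix \<sigma> assume "\<sigma> \<in> {\<sigma>\<in>Sn n. E \<sigma>}"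
        then have s: "\<sigma> \<in> ?f ` (A \<times> B)" "E \<sigma>"
          using bij_betw_imp_surj_on[OF bij] E0 by auto
        then show "\<sigma> \<in> ?f ` (X \<times> Y)" using E by auto
      qed
    qed
    then have "prob n p E = (\<Sum>x\<in>X \<times> Y. p (?f x))"
      unfolding prob_def by (rule sum.reindex_bij_betw[symmetric])
    also have "\<dots> = (\<Sum>\<tau>\<in>X. \<Sum>\<rho>\<in>Y. p (\<pi> \<circ> \<tau> \<circ> \<rho>))"
      by (simp add: sum.cartesian_product case_prod_beta)
    also have "\<dots> = (\<Sum>\<tau>\<in>X. \<Sum>\<rho>\<in>Y. p (\<pi> \<circ> \<tau>) * p (\<pi> \<circ> \<rho>) / p \<pi>)"
      using sub by (intro sum.cong refl fac) auto
    also have "\<dots> = (\<Sum>\<tau>\<in>X. p (\<pi> \<circ> \<tau>)) * (\<Sum>\<rho>\<in>Y. p (\<pi> \<circ> \<rho>)) / p \<pi>"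
      by (simp add: sum_product sum_divide_distrib)
    finally show ?thesis .
  qed
  have pinj: "\<pi> x = \<pi> y \<longleftrightarrow> x = y" for x y using Sn_inj[OF p] by (auto dest: injD)
  have low: "(\<forall>i\<in>{1..k}. (\<pi> \<circ> \<tau> \<circ> \<rho>) i = \<pi> i) \<longleftrightarrow> \<tau> \<in> {id}" if "\<tau> \<in> A" "\<rho> \<in> B" for \<tau> \<rho>
  proof -
    have "\<rho> i = i" if "i \<le> k" for i using \<open>\<rho> \<in> B\<close> that by (auto simp: B_def permutes_def)
    moreover have "\<tau> i = i" if "i \<notin> {1..k}" for i using \<open>\<tau> \<in> A\<close> that by (auto simp: A_def permutes_def)
    ultimately show ?thesis by (auto simp: pinj fun_eq_iff)
  qed
  have img: "(\<pi> \<circ> \<tau> \<circ> \<rho>) ` {1..k} = \<pi> ` {1..k}" if "\<tau> \<in> A" "\<rho> \<in> B" for \<tau> \<rho>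
  proof -
    have "(case (\<tau>, \<rho>) of (\<tau>, \<rho>) \<Rightarrow> \<pi> \<circ> \<tau> \<circ> \<rho>) \<in> {\<sigma>\<in>Sn n. \<sigma> ` {1..k} = \<pi> ` {1..k}}"
      by (rule bij_betwE[OF bij_betw_cut[OF p kn(1)], rule_format]) (use that in \<open>simp add: A_def B_def\<close>)
    then show ?thesis by simp
  qed
  have nxt: "(\<pi> \<circ> \<tau> \<circ> \<rho>) (k + 1) = \<pi> (k + 1) \<longleftrightarrow> \<rho> \<in> B'" if "\<tau> \<in> A" "\<rho> \<in> B" for \<tau> \<rho>
  proof -
    have "\<rho> (k + 1) \<in> {k+1..n}"
      using permutes_in_image[of \<rho> "{k+1..n}" "k + 1"] kn(2) that by (simp add: B_def)
    then have "\<tau> (\<rho> (k + 1)) = \<rho> (k + 1)" using that by (auto simp: A_def permutes_def)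
    then show ?thesis using that by (simp add: pinj B'_def)
  qed
  have idA: "{id} \<subseteq> A" by (auto simp: A_def permutes_id)
  have BB: "B' \<subseteq> B" by (auto simp: B'_def)
  let ?SA = "\<Sum>\<tau>\<in>A. p (\<pi> \<circ> \<tau>)" and ?SB = "\<Sum>\<rho>\<in>B. p (\<pi> \<circ> \<rho>)" and ?SB' = "\<Sum>\<rho>\<in>B'. p (\<pi> \<circ> \<rho>)"
  have pre: "\<sigma> ` {1..k} = \<pi> ` {1..k}" if "\<forall>i\<in>{1..k}. \<sigma> i = \<pi> i" for \<sigma>
    using that by (intro image_cong) auto
  have 1: "prob n p (\<lambda>\<sigma>. \<forall>i\<in>{1..k}. \<sigma> i = \<pi> i) = (\<Sum>\<tau>\<in>{id}. p (\<pi> \<circ> \<tau>)) * ?SB / p \<pi>"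
  proof (rule pr[OF idA order_refl])
    show "(\<forall>i\<in>{1..k}. (\<pi> \<circ> \<tau> \<circ> \<rho>) i = \<pi> i) \<longleftrightarrow> \<tau> \<in> {id} \<and> \<rho> \<in> B" if "\<tau> \<in> A" "\<rho> \<in> B" for \<tau> \<rho>
      using low[OF that] that by blast
  qed (rule pre)
  have 2: "prob n p (\<lambda>\<sigma>. (\<forall>i\<in>{1..k}. \<sigma> i = \<pi> i) \<and> \<sigma> (k+1) = \<pi> (k+1))
      = (\<Sum>\<tau>\<in>{id}. p (\<pi> \<circ> \<tau>)) * ?SB' / p \<pi>"
  proof (rule pr[OF idA BB])
    show "(\<forall>i\<in>{1..k}. (\<pi> \<circ> \<tau> \<circ> \<rho>) i = \<pi> i) \<and> (\<pi> \<circ> \<tau> \<circ> \<rho>) (k+1) = \<pi> (k+1) \<longleftrightarrow> \<tau> \<in> {id} \<and> \<rho> \<in> B'"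
      if "\<tau> \<in> A" "\<rho> \<in> B" for \<tau> \<rho>
      using low[OF that] nxt[OF that] by blast
  qed (rule pre, elim conjE)
  have 3: "prob n p (\<lambda>\<sigma>. \<sigma> ` {1..k} = \<pi> ` {1..k}) = ?SA * ?SB / p \<pi>"
  proof (rule pr[OF order_refl order_refl])
    show "(\<pi> \<circ> \<tau> \<circ> \<rho>) ` {1..k} = \<pi> ` {1..k} \<longleftrightarrow> \<tau> \<in> A \<and> \<rho> \<in> B" if "\<tau> \<in> A" "\<rho> \<in> B" for \<tau> \<rho>
      using img[OF that] that by blast
  qed
  have 4: "prob n p (\<lambda>\<sigma>. \<sigma> ` {1..k} = \<pi> ` {1..k} \<and> \<sigma> (k+1) = \<pi> (k+1)) = ?SA * ?SB' / p \<pi>"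
  proof (rule pr[OF order_refl BB])
    show "(\<pi> \<circ> \<tau> \<circ> \<rho>) ` {1..k} = \<pi> ` {1..k} \<and> (\<pi> \<circ> \<tau> \<circ> \<rho>) (k+1) = \<pi> (k+1) \<longleftrightarrow> \<tau> \<in> A \<and> \<rho> \<in> B'"
      if "\<tau> \<in> A" "\<rho> \<in> B" for \<tau> \<rho>
      using img[OF that] nxt[OF that] that by blast
  qed (elim conjE)
  have pp: "p \<pi> > 0" using pos p by blast
  \<comment> \<open>Positivity lets \<open>?SA\<close> cancel on the right, as
    \<open>p \<pi>\<close> does on the left; both conditional probabilities become
    \<open>?SB' / ?SB\<close>.\<close>
  have "?SA > 0"
  proof (rule sum_pos)
    show "finite A" unfolding A_def by (rule finite_permutations) simp
    show "A \<noteq> {}" using idA by auto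
    show "\<And>\<tau>. \<tau> \<in> A \<Longrightarrow> 0 < p (\<pi> \<circ> \<tau>)"
      using pos p kn permutes_below_Sn by (auto simp: A_def intro!: Sn_comp)
  qed
  then show "prob n p (\<lambda>\<sigma>. (\<forall>i\<in>{1..k}. \<sigma> i = \<pi> i) \<and> \<sigma> (k+1) = \<pi> (k+1))
         / prob n p (\<lambda>\<sigma>. \<forall>i\<in>{1..k}. \<sigma> i = \<pi> i)
       = prob n p (\<lambda>\<sigma>. \<sigma> ` {1..k} = \<pi> ` {1..k} \<and> \<sigma> (k+1) = \<pi> (k+1))
         / prob n p (\<lambda>\<sigma>. \<sigma> ` {1..k} = \<pi> ` {1..k})"
    unfolding 1 2 3 4 using pp by simp
qed

subsection \<open>The log-linear model\<close>

lemma marginal_mat_eqD: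
  assumes "marginal_mat R C \<pi> = marginal_mat R C \<sigma>" "i < length R" "j < length C"
  shows "marginal R C \<pi> i j = marginal R C \<sigma> i j"
proof -
  have "marginal_mat R C \<pi> ! i ! j = marginal_mat R C \<sigma> ! i ! j" using assms(1) by simp
  then show ?thesis using assms(2,3) by (simp add: marginal_mat_def)
qed

text \<open>Composition on the right moves rooks between rows and leaves their columns alone, so
  preserving the row blocks suffices.\<close>

lemma marginal_mat_comp:
  assumes s: "bij \<sigma>" "\<And>B x. B \<in> set R \<Longrightarrow> \<sigma> x \<in> B \<longleftrightarrow> x \<in> B"
  shows "marginal_mat R C (\<pi> \<circ> \<sigma>) = marginal_mat R C \<pi>"
proof -
  have "marginal R C (\<pi> \<circ> \<sigma>) i j = marginal R C \<pi> i j" if "i < length R" for i j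
    unfolding marginal_def
  proof (rule bij_betw_same_card[of \<sigma>], rule bij_betw_imageI)
    have B: "\<sigma> x \<in> R ! i \<longleftrightarrow> x \<in> R ! i" for x using s(2) that by simp
    show "inj_on \<sigma> {x. x \<in> R ! i \<and> (\<pi> \<circ> \<sigma>) x \<in> C ! j}"
      using bij_is_inj[OF s(1)] by (rule inj_on_subset) simp
    show "\<sigma> ` {x. x \<in> R ! i \<and> (\<pi> \<circ> \<sigma>) x \<in> C ! j} = {x. x \<in> R ! i \<and> \<pi> x \<in> C ! j}"
    proof (intro equalityI subsetI)
      fix y assume y: "y \<in> {x. x \<in> R ! i \<and> \<pi> x \<in> C ! j}"
      obtain x where "y = \<sigma> x" using s(1) by (meson bij_pointE)
      then show "y \<in> \<sigma> ` {x. x \<in> R ! i \<and> (\<pi> \<circ> \<sigma>) x \<in> C ! j}" using y B by auto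
    qed (use B in auto)
  qed
  then show ?thesis by (simp add: marginal_mat_def)
qed

lemma Phi_blocks: "B \<in> set (Phi n r) \<Longrightarrow> B = {1..<r} \<or> B = {r} \<or> B = {r+1..n}"
  by (auto simp: Phi_def split: if_splits)

text \<open>One of the two factors of a cut preserves every block of \<^term>\<open>Phi n r\<close>.\<close>
lemma U_B_cut_flat:
  assumes v: "v \<in> U_B n (Phi n r) C" and r: "1 \<le> r" "r \<le> n"
  shows "cut_flat n v"
  unfolding cut_flat_def
proof (intro ballI allI impI)
  fix \<pi> k \<tau> \<rho>
  assume p: "\<pi> \<in> Sn n" and k: "k \<le> n" and h: "\<tau> permutes {1..k} \<and> \<rho> permutes {k+1..n}"
  have t: "\<tau> \<in> Sn n" "\<rho> \<in> Sn n" using h k permutes_below_Sn permutes_above_Sn by auto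
  have veq: "v (\<sigma> \<circ> \<theta>) = v \<sigma>" if "\<sigma> \<in> Sn n" "\<theta> \<in> Sn n" "\<And>B x. B \<in> set (Phi n r) \<Longrightarrow> \<theta> x \<in> B \<longleftrightarrow> x \<in> B" for \<sigma> \<theta>
  proof -
    have "marginal_mat (Phi n r) C (\<sigma> \<circ> \<theta>) = marginal_mat (Phi n r) C \<sigma>"
      by (rule marginal_mat_comp) (use that in \<open>auto simp: Sn_def intro: permutes_bij\<close>)
    then show ?thesis using v Sn_comp[OF that(1,2)] that(1) unfolding U_B_def by blast
  qed
  have rr: "\<rho> x = x" if "x \<notin> {k+1..n}" for x using h that by (simp add: permutes_def)
  have ri: "\<rho> x \<in> {k+1..n}" if "x \<in> {k+1..n}" for x using h that permutes_in_image by metis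
  have tt: "\<tau> x = x" if "x \<notin> {1..k}" for x using h that by (simp add: permutes_def)
  have ti: "\<tau> x \<in> {1..k}" if "x \<in> {1..k}" for x using h that permutes_in_image by metis
  show "v (\<pi> \<circ> \<tau> \<circ> \<rho>) + v \<pi> = v (\<pi> \<circ> \<tau>) + v (\<pi> \<circ> \<rho>)"
  proof (cases "r \<le> k")
    case True
    have "\<rho> x \<in> B \<longleftrightarrow> x \<in> B" if "B \<in> set (Phi n r)" for B x
      using Phi_blocks[OF that] rr[of x] ri[of x] True by (cases "x \<in> {k+1..n}") auto
    then show ?thesis using veq[of _ \<rho>] p t Sn_comp by simp
  next
    case False
    have "\<tau> x \<in> B \<longleftrightarrow> x \<in> B" if "B \<in> set (Phi n r)" for B x
      using Phi_blocks[OF that] tt[of x] ti[of x] False k by (cases "x \<in> {1..k}") auto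
    moreover have "\<tau> \<circ> \<rho> = \<rho> \<circ> \<tau>"
    proof
      fix x show "(\<tau> \<circ> \<rho>) x = (\<rho> \<circ> \<tau>) x"
      proof (cases "x \<in> {1..k}")
        case True
        then show ?thesis using rr[of x] rr[of "\<tau> x"] ti[of x] by simp
      next
        case a: False
        show ?thesis
        proof (cases "x \<in> {k+1..n}")
          case True
          then show ?thesis using tt[OF a] tt[of "\<rho> x"] ri[of x] by simp
        next
          case False
          then show ?thesis using rr[of x] tt[OF a] by simp
        qed
      qed
    qed
    ultimately show ?thesis
      using veq[of \<pi> \<tau>] veq[of "\<pi> \<circ> \<rho>" \<tau>] p t Sn_comp[of \<pi> n \<rho>] by (simp add: comp_assoc)
  qed
qed

lemma marginal_inv:
  assumes p: "\<pi> \<in> Sn n"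
  shows "marginal R C (inv \<pi>) i j = marginal C R \<pi> j i"
  unfolding marginal_def
proof (rule bij_betw_same_card[of "inv \<pi>"], rule bij_betw_imageI)
  have b: "\<pi> (inv \<pi> x) = x" "inv \<pi> (\<pi> x) = x" for x
    using p by (auto simp: Sn_def permutes_inverses)
  show "inj_on (inv \<pi>) {s. s \<in> R ! i \<and> inv \<pi> s \<in> C ! j}"
    using Sn_inj[OF Sn_inv[OF p]] by (rule inj_on_subset) simp
  show "inv \<pi> ` {s. s \<in> R ! i \<and> inv \<pi> s \<in> C ! j} = {s. s \<in> C ! j \<and> \<pi> s \<in> R ! i}"
    using b by (auto intro!: image_eqI[of _ _ "\<pi> _"])
qed

text \<open>Inversion transposes the board and with it the marginal. Outside \<open>Sn n\<close> the
  value 0 is set explicitly, since \<open>inv\<close> is not controlled there.\<close>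

lemma U_B_inv:
  assumes "v \<in> U_B n R C"
  shows "(\<lambda>\<pi>. if \<pi> \<in> Sn n then v (inv \<pi>) else 0) \<in> U_B n C R"
proof -
  have veq: "v (inv \<pi>) = v (inv \<sigma>)"
    if "\<pi> \<in> Sn n" "\<sigma> \<in> Sn n" "marginal_mat C R \<pi> = marginal_mat C R \<sigma>" for \<pi> \<sigma>
  proof -
    have "marginal_mat R C (inv \<pi>) = marginal_mat R C (inv \<sigma>)"
      using marginal_mat_eqD[OF that(3)] by (simp add: marginal_mat_def marginal_inv[OF that(1)] marginal_inv[OF that(2)])
    then show ?thesis using assms that(1,2) Sn_inv unfolding U_B_def by blast
  qed
  show ?thesis
    unfolding U_B_def mem_Collect_eq
  proof (intro conjI allI ballI impI)
    fix \<pi> \<sigma> assume h: "\<pi> \<in> Sn n" "\<sigma> \<in> Sn n" "marginal_mat C R \<pi> = marginal_mat C R \<sigma>"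
    show "(if \<pi> \<in> Sn n then v (inv \<pi>) else 0) = (if \<sigma> \<in> Sn n then v (inv \<sigma>) else 0)"
      using veq[OF h] h(1,2) by (simp only: if_True)
  qed simp
qed

text \<open>An intermediate space: it contains the span of the bold sections, is contained in the
  span of the indicator functions, and is strong enough to imply L-decomposability on both
  sides.\<close>

definition bi_flat :: "nat \<Rightarrow> ((nat \<Rightarrow> nat) \<Rightarrow> real) \<Rightarrow> bool" where
  "bi_flat n v \<longleftrightarrow> (\<forall>\<pi>. \<pi> \<notin> Sn n \<longrightarrow> v \<pi> = 0) \<and> cut_flat n v \<and> cut_flat n (\<lambda>\<pi>. v (inv \<pi>))"

lemma cut_flat_cong:
  assumes "cut_flat n v" "\<And>\<pi>. \<pi> \<in> Sn n \<Longrightarrow> v \<pi> = w \<pi>"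
  shows "cut_flat n w"
  unfolding cut_flat_def
proof (intro ballI allI impI)
  fix \<pi> k \<tau> \<rho>
  assume p: "\<pi> \<in> Sn n" and k: "k \<le> n" and h: "\<tau> permutes {1..k} \<and> \<rho> permutes {k+1..n}"
  have t: "\<tau> \<in> Sn n" "\<rho> \<in> Sn n" using h k permutes_below_Sn permutes_above_Sn by auto
  have "v (\<pi> \<circ> \<tau> \<circ> \<rho>) + v \<pi> = v (\<pi> \<circ> \<tau>) + v (\<pi> \<circ> \<rho>)"
    using assms(1) p k h unfolding cut_flat_def by blast
  then show "w (\<pi> \<circ> \<tau> \<circ> \<rho>) + w \<pi> = w (\<pi> \<circ> \<tau>) + w (\<pi> \<circ> \<rho>)"
    using assms(2) p t by (simp add: Sn_comp)
qed

lemma subspace_bi_flat: "fvs.subspace {v. bi_flat n v}"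
proof -
  have add: "cut_flat n (\<lambda>\<pi>. v \<pi> + w \<pi>)" if "cut_flat n v" "cut_flat n w" for v w
    unfolding cut_flat_def
  proof (intro ballI allI impI)
    fix \<pi> k \<tau> \<rho>
    assume h: "\<pi> \<in> Sn n" "k \<le> n" "\<tau> permutes {1..k} \<and> \<rho> permutes {k+1..n}"
    have "v (\<pi> \<circ> \<tau> \<circ> \<rho>) + v \<pi> = v (\<pi> \<circ> \<tau>) + v (\<pi> \<circ> \<rho>)"
      "w (\<pi> \<circ> \<tau> \<circ> \<rho>) + w \<pi> = w (\<pi> \<circ> \<tau>) + w (\<pi> \<circ> \<rho>)"
      using that h unfolding cut_flat_def by blast+
    then show "v (\<pi> \<circ> \<tau> \<circ> \<rho>) + w (\<pi> \<circ> \<tau> \<circ> \<rho>) + (v \<pi> + w \<pi>)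
        = v (\<pi> \<circ> \<tau>) + w (\<pi> \<circ> \<tau>) + (v (\<pi> \<circ> \<rho>) + w (\<pi> \<circ> \<rho>))" by linarith
  qed
  have scale: "cut_flat n (\<lambda>\<pi>. c * v \<pi>)" if "cut_flat n v" for c v
    using that unfolding cut_flat_def by (simp add: distrib_left[symmetric])
  show ?thesis
    using add scale by (auto simp: fvs.subspace_def bi_flat_def fscale_def plus_fun_def zero_fun_def cut_flat_def[of n "\<lambda>_. 0"])
qed

text \<open>On each generator, flatness of \<open>v\<close> comes from the row section, and flatness
  of its composition with inversion comes from the column section after transposing the
  board.\<close>

lemma U_span_bi_flat:
  assumes "v \<in> U_span n (bold_family n)"
  shows "bi_flat n v"
proof -
  have "bi_flat n w" if "w \<in> U_B n (Phi n k) (Phi n l)" "1 \<le> k" "k \<le> n" "1 \<le> l" "l \<le> n" for w k l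
  proof -
    have "w \<pi> = 0" if "\<pi> \<notin> Sn n" for \<pi>
      using \<open>w \<in> U_B n (Phi n k) (Phi n l)\<close> that unfolding U_B_def by blast
    moreover have "cut_flat n (\<lambda>\<pi>. w (inv \<pi>))"
      by (rule cut_flat_cong[OF U_B_cut_flat[OF U_B_inv[OF that(1)] that(4,5)]]) simp
    ultimately show ?thesis
      using U_B_cut_flat[OF that(1-3)] unfolding bi_flat_def by blast
  qed
  then have "(\<Union>(R, C)\<in>bold_family n. U_B n R C) \<subseteq> {v. bi_flat n v}"
    by (auto simp: bold_family_def)
  then show ?thesis
    using assms fvs.span_minimal[OF _ subspace_bi_flat] unfolding U_span_def by blast
qed

lemma flat_if_cut_flat:
  assumes "cut_flat n v"
  shows "flat n v"
  unfolding flat_def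
proof (intro ballI allI impI)
  fix \<pi> i j assume p: "\<pi> \<in> Sn n" and ij: "1 \<le> i \<and> Suc i < j \<and> j < n"
  have "adj i permutes {1..Suc i}" "adj j permutes {Suc i + 1..n}"
    using ij by (auto intro!: permutes_swap_id)
  moreover have "Suc i \<le> n" using ij by simp
  ultimately have "v (\<pi> \<circ> adj i \<circ> adj j) + v \<pi> = v (\<pi> \<circ> adj i) + v (\<pi> \<circ> adj j)"
    using assms p unfolding cut_flat_def by blast
  then show "v \<pi> + v (\<pi> \<circ> adj i \<circ> adj j) = v (\<pi> \<circ> adj i) + v (\<pi> \<circ> adj j)" by simp
qed

section \<open>Indicator functions as a basis of the span\<close>

definition mark :: "nat \<Rightarrow> nat \<times> nat \<times> nat \<times> nat \<Rightarrow> (nat \<Rightarrow> nat) \<Rightarrow> real" where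
  "mark n j \<pi> = (if marked n j \<pi> then 1 else 0)"

text \<open>\<open>block_swap i\<close> has exactly \<open>bound i\<close> inversions, whereas
  permutations in the support of \<open>mark n j\<close> have at least \<open>bound j\<close>, with
  equality only for \<open>block_swap j\<close>.\<close>

lemma mark_triangular:
  assumes "i \<in> params0 n" "j \<in> params0 n" "mark n j (block_swap i) \<noteq> 0"
  shows "i = j \<or> bound j < bound i"
proof -
  have m: "marked n j (block_swap i)" using assms(3) by (simp add: mark_def split: if_splits)
  have i: "card (invs n (block_swap i)) = bound i"
    using marked_inversions(2)[OF assms(1) block_swap_marked[OF assms(1)]] block_swap_tight[OF assms(1)] by simp
  show ?thesis
  proof (cases "bound j < bound i")
    case False
    then have "tight n j (block_swap i)"
      using marked_inversions[OF assms(2) m] i by simp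
    then have "block_swap i = block_swap j"
      using tight_unique[OF assms(2) m _ block_swap_marked[OF assms(2)] block_swap_tight[OF assms(2)]] by simp
    then show ?thesis using inj_block_swap assms(1,2) by (auto dest: inj_onD)
  qed simp
qed

lemma mark_in_U_span:
  assumes n: "n \<ge> 1" and j: "j \<in> params0 n"
  shows "mark n j \<in> U_span n (bold_family n)"
proof -
  have sub: "U_B n (Phi n k) (Phi n l) \<subseteq> U_span n (bold_family n)"
    if "1 \<le> k" "k \<le> n" "1 \<le> l" "l \<le> n" for k l
    unfolding U_span_def using that
    by (intro subset_trans[OF _ fvs.span_superset]) (auto simp: bold_family_def)
  obtain k l a e where jj: "j = (k, l, a, e)" by (cases j) auto
  show ?thesis
  proof (cases "(k, l, a, e) \<in> params n")
    case False
    then have j0: "j = (0, 0, 0, 0)" using j by (auto simp: params0_def jj)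
    \<comment> \<open>This mark is the indicator of all of \<open>Sn n\<close>, so it lies in
      \<open>U_B\<close> for any partition.\<close>
    have "mark n j \<in> U_B n (Phi n 1) (Phi n 1)"
      by (auto simp: j0 mark_def U_B_def marked_def rk_def)
    then show ?thesis using sub[of 1 1] n by auto
  next
    case True
    then have b: "1 \<le> k" "1 \<le> l" "k + 1 \<le> n" "l + 1 \<le> n" by (auto simp: params_def)
    \<comment> \<open>The shift by one makes \<open>{1..k}\<close> and \<open>{k + 1}\<close> the
      first two blocks. As \<open>k\<close> and \<open>l\<close> are positive, no leading block is
      filtered out, and the indices 0 and 1 address these blocks.\<close>
    let ?R = "Phi n (k + 1)" and ?C = "Phi n (l + 1)"
    have len: "0 < length (Phi n (m + 1))" "1 < length (Phi n (m + 1))"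
        "Phi n (m + 1) ! 0 = {1..<m + 1}" "Phi n (m + 1) ! 1 = {m + 1}" if "1 \<le> m" for m
      using that by (auto simp: Phi_def)
    have "mark n j \<pi> = mark n j \<sigma>"
      if p: "\<pi> \<in> Sn n" "\<sigma> \<in> Sn n" and m: "marginal_mat ?R ?C \<pi> = marginal_mat ?R ?C \<sigma>" for \<pi> \<sigma>
    proof -
      have r: "rk \<theta> k l = marginal ?R ?C \<theta> 0 0" if "\<theta> \<in> Sn n" for \<theta>
      proof -
        have "{i \<in> {1..k}. \<theta> i \<le> l} = {s. s \<in> {1..<k + 1} \<and> \<theta> s \<in> {1..<l + 1}}"
          by (auto intro: Sn_ge1[OF that])
        then show ?thesis using len(3) b unfolding rk_def marginal_def by simp
      qed
      have q: "\<theta> (k + 1) = l + 1 \<longleftrightarrow> marginal ?R ?C \<theta> 1 1 = 1" for \<theta>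
      proof -
        have "{s. s \<in> {k + 1} \<and> \<theta> s \<in> {l + 1}} = (if \<theta> (k + 1) = l + 1 then {k + 1} else {})" by auto
        then show ?thesis unfolding marginal_def len(4)[OF b(1)] len(4)[OF b(2)] by simp
      qed
      have "rk \<pi> k l = rk \<sigma> k l" "\<pi> (k + 1) = l + 1 \<longleftrightarrow> \<sigma> (k + 1) = l + 1"
        unfolding r[OF p(1)] r[OF p(2)] q
        using marginal_mat_eqD[OF m len(1)[OF b(1)] len(1)[OF b(2)]]
          marginal_mat_eqD[OF m len(2)[OF b(1)] len(2)[OF b(2)]] by simp_all
      then show ?thesis using p by (simp add: mark_def marked_def jj)
    qed
    moreover have "mark n j \<pi> = 0" if "\<pi> \<notin> Sn n" for \<pi>
      using that by (simp add: mark_def marked_def jj)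
    ultimately have "mark n j \<in> U_B n ?R ?C" unfolding U_B_def by blast
    then show ?thesis using sub[of "k + 1" "l + 1"] b by auto
  qed
qed

lemma finite_params0: "finite (params0 n)"
  by (rule finite_subset[of _ "{..n} \<times> {..n} \<times> {..n} \<times> {..1}"])
    (auto simp: params0_def params_def)

lemma mark_block_swap: "j \<in> params0 n \<Longrightarrow> mark n j (block_swap j) = 1"
  using block_swap_marked by (simp add: mark_def)

text \<open>Interpolate \<open>v\<close> by marks at the extremal permutations. The difference is
  flat on both sides and vanishes at all of them, so it is zero.\<close>

lemma flat_in_span_mark:
  assumes n: "n \<ge> 1" and z: "\<And>\<pi>. \<pi> \<notin> Sn n \<Longrightarrow> v \<pi> = 0"
    and fl: "flat n v" "flat n (\<lambda>\<pi>. v (inv \<pi>))"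
  shows "v \<in> fvs.span (mark n ` params0 n)"
proof -
  obtain c where c: "\<forall>i\<in>params0 n. (\<Sum>j\<in>params0 n. c j * mark n j (block_swap i)) = v (block_swap i)"
    using triangular_interpolation[where u = "mark n" and t = block_swap and \<mu> = bound and v = v
        and I = "params0 n"] finite_params0 mark_block_swap mark_triangular by metis
  define w where "w = (\<Sum>j\<in>params0 n. fscale (c j) (mark n j))"
  have w: "w \<pi> = (\<Sum>j\<in>params0 n. c j * mark n j \<pi>)" for \<pi>
    by (simp add: w_def sum_apply_fun fscale_def)
  have ws: "w \<in> fvs.span (mark n ` params0 n)"
    unfolding w_def by (intro fvs.span_sum fvs.span_scale fvs.span_base) auto
  have "w \<in> U_span n (bold_family n)"
    unfolding w_def U_span_def
    using mark_in_U_span[OF n] unfolding U_span_def by (intro fvs.span_sum fvs.span_scale) auto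
  then have wb: "bi_flat n w" by (rule U_span_bi_flat)
  have diff: "flat n (\<lambda>\<pi>. f \<pi> - g \<pi>)" if "flat n f" "flat n g" for f g
    unfolding flat_def
  proof (intro ballI allI impI)
    fix \<pi> i j assume h: "\<pi> \<in> Sn n" "1 \<le> i \<and> Suc i < j \<and> j < n"
    have "f \<pi> + f (\<pi> \<circ> adj i \<circ> adj j) = f (\<pi> \<circ> adj i) + f (\<pi> \<circ> adj j)"
      "g \<pi> + g (\<pi> \<circ> adj i \<circ> adj j) = g (\<pi> \<circ> adj i) + g (\<pi> \<circ> adj j)"
      using that h unfolding flat_def by blast+
    then show "f \<pi> - g \<pi> + (f (\<pi> \<circ> adj i \<circ> adj j) - g (\<pi> \<circ> adj i \<circ> adj j))
        = f (\<pi> \<circ> adj i) - g (\<pi> \<circ> adj i) + (f (\<pi> \<circ> adj j) - g (\<pi> \<circ> adj j))" by linarith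
  qed
  have fw: "flat n w" "flat n (\<lambda>\<pi>. w (inv \<pi>))"
    using wb by (auto simp: bi_flat_def intro: flat_if_cut_flat)
  have "v \<pi> - w \<pi> = 0" if "\<pi> \<in> Sn n" for \<pi>
  proof (rule flat_eq_0[of n "\<lambda>\<pi>. v \<pi> - w \<pi>"])
    show "flat n (\<lambda>\<pi>. v \<pi> - w \<pi>)" "flat n (\<lambda>\<pi>. v (inv \<pi>) - w (inv \<pi>))"
      by (rule diff[OF fl(1) fw(1)], rule diff[OF fl(2) fw(2)])
  qed (use c that in \<open>auto simp: w\<close>)
  moreover have "w \<pi> = 0" if "\<pi> \<notin> Sn n" for \<pi> using wb that by (simp add: bi_flat_def)
  ultimately have "v = w" using z by (fastforce simp: fun_eq_iff)
  then show ?thesis using ws by simp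
qed

lemma U_span_eq:
  assumes "n \<ge> 1"
  shows "U_span n (bold_family n) = fvs.span (mark n ` params0 n)"
proof
  show "U_span n (bold_family n) \<subseteq> fvs.span (mark n ` params0 n)"
  proof
    fix v assume "v \<in> U_span n (bold_family n)"
    then have "bi_flat n v" by (rule U_span_bi_flat)
    then show "v \<in> fvs.span (mark n ` params0 n)"
      by (intro flat_in_span_mark[OF assms]) (auto simp: bi_flat_def intro: flat_if_cut_flat)
  qed
  show "fvs.span (mark n ` params0 n) \<subseteq> U_span n (bold_family n)"
    unfolding U_span_def
    by (rule fvs.span_minimal) (use mark_in_U_span[OF assms] in \<open>auto simp: U_span_def\<close>)
qed

lemma dim_U_span:
  assumes "n \<ge> 1"
  shows "fvs.dim (U_span n (bold_family n)) = card (params0 n)"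
proof -
  have ind: "inj_on (mark n) (params0 n)" "fvs.independent (mark n ` params0 n)"
    using triangular_independent[where u = "mark n" and t = block_swap and \<mu> = bound
        and I = "params0 n"] finite_params0 mark_block_swap mark_triangular by metis+
  show ?thesis
    unfolding U_span_eq[OF assms] fvs.dim_span_eq_card_independent[OF ind(2)] card_image[OF ind(1)] ..
qed

section \<open>Counting the free parameters\<close>

lemma card_params_Suc: "card (params (Suc n)) = card (params n) + n\<^sup>2"
proof -
  let ?D = "{1..n} \<times> {1..n}"
  \<comment> \<open>The new quadruples satisfy \<open>k + l + e = Suc n + a\<close>, so
    \<open>a\<close> is determined by the rest. For \<open>e = 0\<close> the pairs
    \<open>(k, l)\<close> fill the part of the square with sum above \<open>n\<close>; for
    \<open>e = 1\<close> the complementary pairs \<open>(n - k, n - l)\<close> fill the other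
    part.\<close>
  define f :: "nat \<times> nat \<Rightarrow> nat \<times> nat \<times> nat \<times> nat" where
    "f = (\<lambda>(x, y). if n < x + y then (x, y, x + y - Suc n, 0) else (n - x, n - y, n - x - y, 1))"
  have inj: "inj_on f ?D"
    by (auto simp: inj_on_def f_def split: if_splits)
  have im: "f ` ?D = params (Suc n) - params n"
  proof (intro equalityI subsetI)
    fix j assume "j \<in> f ` ?D"
    then show "j \<in> params (Suc n) - params n"
      by (auto simp: f_def params_def split: if_splits)
  next
    fix j assume J: "j \<in> params (Suc n) - params n"
    obtain k l a e where jj: "j = (k, l, a, e)" by (cases j) auto
    have b: "a < k" "a < l" "k + l + e = Suc n + a" "e \<le> 1"
      using J by (auto simp: jj params_def)
    show "j \<in> f ` ?D"
    proof (cases "e = 0")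
      case True
      then show ?thesis
        using b by (intro image_eqI[of _ _ "(k, l)"]) (auto simp: jj f_def)
    next
      case False
      then show ?thesis
        using b by (intro image_eqI[of _ _ "(n - k, n - l)"]) (auto simp: jj f_def)
    qed
  qed
  have sub: "params n \<subseteq> params (Suc n)" by (auto simp: params_def)
  have fin: "finite (params m)" for m
    using finite_params0[of m] by (simp add: params0_def)
  have "card (params (Suc n)) = card (params n) + card (params (Suc n) - params n)"
    using sub fin by (metis card_mono card_Diff_subset le_add_diff_inverse)
  also have "card (params (Suc n) - params n) = n\<^sup>2"
    unfolding im[symmetric] card_image[OF inj] by (simp add: power2_eq_square)
  finally show ?thesis .
qed

lemma card_params: "card (params n) = (\<Sum>i = 1..n-1. i\<^sup>2)"
proof (induction n)
  case 0
  have "params 0 = {}" by (auto simp: params_def)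
  then show ?case by simp
next
  case (Suc n)
  then show ?case by (cases n) (auto simp: card_params_Suc)
qed

section \<open>Bi-decomposability and membership in the span\<close>

lemma flat_log_dist:
  assumes "\<forall>\<pi>\<in>Sn n. p \<pi> > 0" "L_decomposable n p"
  shows "flat n (log_dist n p)"
  unfolding flat_def
proof (intro ballI allI impI)
  fix \<pi> i j assume p: "\<pi> \<in> Sn n" and ij: "1 \<le> i \<and> Suc i < j \<and> j < n"
  have S: "\<pi> \<circ> adj i \<in> Sn n" "\<pi> \<circ> adj j \<in> Sn n" "\<pi> \<circ> adj i \<circ> adj j \<in> Sn n"
    using p ij by (auto intro!: Sn_comp adj_Sn)
  have pos: "p \<pi> > 0" "p (\<pi> \<circ> adj i) > 0" "p (\<pi> \<circ> adj j) > 0" "p (\<pi> \<circ> adj i \<circ> adj j) > 0"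
    using assms(1) p S by blast+
  have "p \<pi> * p (\<pi> \<circ> adj i \<circ> adj j) = p (\<pi> \<circ> adj i) * p (\<pi> \<circ> adj j)"
    using L_decomposable_imp_commuting_square[OF assms p] ij by blast
  then have "ln (p \<pi> * p (\<pi> \<circ> adj i \<circ> adj j)) = ln (p (\<pi> \<circ> adj i) * p (\<pi> \<circ> adj j))" by simp
  then show "log_dist n p \<pi> + log_dist n p (\<pi> \<circ> adj i \<circ> adj j)
      = log_dist n p (\<pi> \<circ> adj i) + log_dist n p (\<pi> \<circ> adj j)"
    using S p pos by (simp add: log_dist_def ln_mult_pos)
qed

lemma flat_cong:
  assumes "flat n v" "\<And>\<pi>. \<pi> \<in> Sn n \<Longrightarrow> v \<pi> = w \<pi>"
  shows "flat n w"
  unfolding flat_def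
proof (intro ballI allI impI)
  fix \<pi> i j assume p: "\<pi> \<in> Sn n" and ij: "1 \<le> i \<and> Suc i < j \<and> j < n"
  have S: "\<pi> \<circ> adj i \<in> Sn n" "\<pi> \<circ> adj j \<in> Sn n" "\<pi> \<circ> adj i \<circ> adj j \<in> Sn n"
    using p ij by (auto intro!: Sn_comp adj_Sn)
  show "w \<pi> + w (\<pi> \<circ> adj i \<circ> adj j) = w (\<pi> \<circ> adj i) + w (\<pi> \<circ> adj j)"
    using assms(1) p ij unfolding flat_def by (simp flip: assms(2)[OF p] assms(2)[OF S(1)] assms(2)[OF S(2)] assms(2)[OF S(3)])
qed

lemma log_dist_inv:
  "\<pi> \<in> Sn n \<Longrightarrow> log_dist n (\<lambda>\<pi>. p (inv \<pi>)) \<pi> = log_dist n p (inv \<pi>)"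
  by (simp add: log_dist_def Sn_inv)

text \<open>From bi-decomposability only \<open>flat\<close> on both sides is derived, which
  suffices for membership in the span. Membership in turn yields the stronger
  \<open>cut_flat\<close>, from which L-decomposability is recovered.\<close>

lemma bi_decomposable_iff:
  assumes n: "n \<ge> 1" and p: "p \<in> pos_dist n"
  shows "bi_decomposable n p \<longleftrightarrow> log_dist n p \<in> U_span n (bold_family n)"
proof
  have pos: "\<forall>\<pi>\<in>Sn n. p \<pi> > 0" using p by (simp add: pos_dist_def)
  then have pos': "\<forall>\<pi>\<in>Sn n. p (inv \<pi>) > 0" using Sn_inv by blast
  {
    assume "bi_decomposable n p"
    then have L: "L_decomposable n p" "L_decomposable n (\<lambda>\<pi>. p (inv \<pi>))" by (auto simp: bi_decomposable_def)
    have "log_dist n p \<in> fvs.span (mark n ` params0 n)"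
    proof (rule flat_in_span_mark[OF n])
      show "flat n (log_dist n p)" by (rule flat_log_dist[OF pos L(1)])
      show "flat n (\<lambda>\<pi>. log_dist n p (inv \<pi>))"
        by (rule flat_cong[OF flat_log_dist[OF pos' L(2)] log_dist_inv])
    qed (simp add: log_dist_def)
    then show "log_dist n p \<in> U_span n (bold_family n)" by (simp add: U_span_eq[OF n])
  next
    assume "log_dist n p \<in> U_span n (bold_family n)"
    then have "cut_flat n (log_dist n p)" "cut_flat n (\<lambda>\<pi>. log_dist n p (inv \<pi>))"
      using U_span_bi_flat by (auto simp: bi_flat_def)
    then show "bi_decomposable n p"
      unfolding bi_decomposable_def
      using L_decomposable_if_cut_flat[OF pos] L_decomposable_if_cut_flat[OF pos']
        cut_flat_cong[of n "\<lambda>\<pi>. log_dist n p (inv \<pi>)" "log_dist n (\<lambda>\<pi>. p (inv \<pi>))"] log_dist_inv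
      by simp
  }
qed

theorem theorem1:
  fixes n :: nat
  assumes "n \<ge> 1"
  shows "Pb_plus n = loglinear n (bold_family n)
         \<and> int (fvs.dim (U_span n (bold_family n))) - 1 = (\<Sum>i=1..n-1. int (i^2))"
proof
  show "Pb_plus n = loglinear n (bold_family n)"
    using bi_decomposable_iff[OF assms] by (auto simp: Pb_plus_def loglinear_def log_dist_def)
  \<comment> \<open>The quadruple \<open>(0, 0, 0, 0)\<close> contributes the constant direction,
    which is the dimension subtracted for normalization.\<close>
  have "finite (params n)" "(0, 0, 0, 0) \<notin> params n"
    using finite_params0[of n] by (auto simp: params0_def params_def)
  then have "card (params0 n) = Suc (card (params n))" by (simp add: params0_def)
  then show "int (fvs.dim (U_span n (bold_family n))) - 1 = (\<Sum>i=1..n-1. int (i^2))"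
    by (simp add: dim_U_span[OF assms] card_params)
qed

end
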